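(* For every $\sigma>0$, $s\in\mathbb{N}$ and $0<p<q\leq\infty$, the following relation holds: $$\sup_{\substack{f\in E_{\sigma,p},\\ \|f\|_p=1}}\big\|f^{(s)}\big\|_q\asymp_{p,q}\sigma^s\left(\frac{\sigma}{s}\right)^{\frac1p-\frac1q}.$$
   Context: For $p\in(0,\infty)$, $\|f\|_p:=\left(\int_{\mathbb{R}}|f(x)|^p\,dx\right)^{1/p}$, and $\|f\|_\infty$ is the (essential) supremum of $|f|$ on $\mathbb{R}$. An entire function $f:\mathbb{C}\to\mathbb{C}$ is of exponential type $\sigma$ if for every $\varepsilon>0$ there is a constant $C_{\varepsilon,f}$ such that $|f(z)|\le C_{\varepsilon,f}e^{(\sigma+\varepsilon)|z|}$ for all $z\in\mathbb{C}$. $E_{\sigma,p}$ is the space of all complex-valued entire functions $f$ of exponential type $\sigma>0$ with $\|f\|_p<\infty$. By convention $1/\infty=0$. The notation $A\asymp_{p,q}B$ means that there are constants $C_1,C_2>0$ depending only on $p$ and $q$ (in particular independent of $s$ and $\sigma$) such that $C_2B\le A\le C_1B$. *)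

theory Defs
  imports "HOL-Complex_Analysis.Complex_Analysis" "HOL-Probability.Essential_Supremum"
begin

text \<open>
  The (quasi-)norm of \<open>L\<^sup>p(\<real>)\<close> for \<open>0 < p \<le> \<infinity>\<close>; for \<open>p < 1\<close> it is only a quasi-norm.
  The library has no powers with base in \<^typ>\<open>ennreal\<close>, and \<^const>\<open>enn2real\<close> sends \<open>\<infinity>\<close> to \<open>0\<close>,
  so an infinite integral is treated separately.
\<close>

definition Lp_norm :: "ennreal \<Rightarrow> (real \<Rightarrow> complex) \<Rightarrow> ennreal" where
  "Lp_norm p f =
    (if p = \<infinity> then esssup lborel (\<lambda>x. ennreal (norm (f x)))
     else let I = (\<integral>\<^sup>+ x. ennreal (norm (f x) powr enn2real p) \<partial>lborel)
          in if I = \<infinity> then \<infinity> else ennreal (enn2real I powr (1 / enn2real p)))"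

abbreviation on_reals :: "(complex \<Rightarrow> complex) \<Rightarrow> real \<Rightarrow> complex" where
  "on_reals f \<equiv> (\<lambda>x. f (complex_of_real x))"

definition exponential_type :: "real \<Rightarrow> (complex \<Rightarrow> complex) \<Rightarrow> bool" where
  "exponential_type \<sigma> f \<longleftrightarrow>
    (\<forall>\<epsilon>>0. \<exists>C. \<forall>z. norm (f z) \<le> C * exp ((\<sigma> + \<epsilon>) * norm z))"

definition E_space :: "real \<Rightarrow> ennreal \<Rightarrow> (complex \<Rightarrow> complex) set" where
  "E_space \<sigma> p =
    {f. f holomorphic_on UNIV \<and> exponential_type \<sigma> f \<and> Lp_norm p (on_reals f) < \<infinity>}"

end

theory Submission
  imports Defs "HOL-Probability.Sinc_Integral"
begin

text \<open>
Let \<open>r = s / \<sigma>\<close>. In Cauchy's formula for \<open>f\<^sup>(\<^sup>s\<^sup>) x\<close> on the circle of radius \<open>r\<close>, a function of type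
\<open>\<sigma>\<close> has modulus about \<open>exp (\<sigma> \<bar>Im w\<bar>)\<close> times a tame factor, so that the points near \<open>x \<plusminus> \<i> r\<close>
dominate: the mean of \<open>exp (s \<bar>sin \<theta>\<bar>)\<close> is of order \<open>exp s / sqrt s\<close>, and Stirling's formula turns
\<open>s! / r ^ s\<close> times this mean into \<open>\<sigma> ^ s\<close> up to a constant. Near \<open>x \<plusminus> \<i> r\<close> the tame factor is
\<open>\<bar>F\<bar>\<close> with \<open>F w = f w exp (\<plusminus> \<i> \<sigma> w)\<close>, and \<open>\<bar>F w\<bar> ^ p\<close> is at most a constant times the mean of
\<open>\<bar>F\<bar> ^ p\<close> over a disc of radius \<open>r / 2\<close>. This holds for every \<open>p > 0\<close> and yields the pointwise estimate
\<open>\<bar>f\<^sup>(\<^sup>s\<^sup>) x\<bar> ^ p \<le> C \<sigma> ^ (s p) J x / r\<^sup>2\<close>, where \<open>J x\<close> is the integral of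
\<open>\<bar>f (u + \<i> y)\<bar> ^ p exp (- p \<sigma> \<bar>y\<bar>)\<close> over a square of side \<open>4 r\<close> about \<open>x\<close>
(\<open>higher_deriv_powr_le_weighted_area\<close>).

By the Plancherel-Polya inequality (\<open>plancherel_polya\<close>), the integral of
\<open>\<bar>f (u + \<i> y)\<bar> ^ p exp (- p \<sigma> \<bar>y\<bar>)\<close> in \<open>u\<close> is at most the \<open>p\<close>-th power of the norm of \<open>f\<close>, for every
\<open>y\<close>. For a normalised \<open>f\<close> therefore \<open>J \<le> 4 r\<close>, while the integral of \<open>J\<close> over the line is at most
\<open>16 r\<^sup>2\<close>. The first fact bounds \<open>f\<^sup>(\<^sup>s\<^sup>)\<close> uniformly by \<open>\<sigma> ^ s r powr (- 1/p)\<close>, the second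
bounds its \<open>p\<close>-norm by \<open>\<sigma> ^ s\<close>, up to constants, and interpolation between the two gives the factor
\<open>r powr (1/q - 1/p)\<close>.

The Plancherel-Polya inequality rests on a Phragmen-Lindelof argument for
\<open>U z = \<integral> \<bar>f (z + t)\<bar> ^ p dt\<close> over a bounded interval. Such an integral is log-subharmonic; what is used is
that \<open>U exp (Re g)\<close> obeys the maximum principle for every holomorphic \<open>g\<close>. This is proved for finite sums of
\<open>\<bar>F\<^sub>j\<bar> ^ p\<close> by applying the maximum modulus principle to a sum of suitably rotated branches of
\<open>F\<^sub>j ^ p\<close>, and passes to integrals through Riemann sums.

For the lower bound take a fixed entire function \<open>g\<close>, a power of \<open>sin z / z\<close>, and slow it down and shift it
in frequency: \<open>f z = A g (b z) exp (\<i> a z)\<close> with \<open>b\<close> a small multiple of \<open>\<sigma> / s\<close> and \<open>a\<close> as large as the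
type \<open>\<sigma>\<close> admits. The frequencies of \<open>f\<close> then lie within order \<open>\<sigma> / s\<close> of \<open>\<sigma>\<close>, each of the \<open>s\<close>
differentiations multiplies \<open>f\<close> by about \<open>\<sigma>\<close>, and \<open>\<bar>f\<^sup>(\<^sup>s\<^sup>)\<bar>\<close> stays comparable to
\<open>A \<sigma> ^ s\<close> on an interval of length of order \<open>s / \<sigma>\<close>.
\<close>

section \<open>The maximum principle for integrals of powers of moduli\<close>

text \<open>
If \<open>F\<^sub>j w \<noteq> 0\<close>, then \<open>F\<^sub>j\<close> has a holomorphic \<open>p\<close>-th power near \<open>w\<close>. Rotating these powers so that they
are positive at \<open>w\<close> and adding them produces a holomorphic \<open>H\<close> with \<open>\<bar>H\<bar> \<le> S\<close> and equality at \<open>w\<close>, where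
\<open>S\<close> is the given sum. A local maximum of \<open>S\<close> at \<open>w\<close> is thus one of \<open>\<bar>H\<bar>\<close>, and \<open>H\<close> is constant.
\<close>

lemma powr_sum_local_max_const:
  fixes F :: "'i \<Rightarrow> complex \<Rightarrow> complex"
  assumes "finite J" "0 < p" "open V" "w \<in> V"
    and hol: "\<And>j. j \<in> J \<Longrightarrow> F j holomorphic_on V"
    and le: "\<And>z. z \<in> V \<Longrightarrow> (\<Sum>j\<in>J. norm (F j z) powr p) \<le> (\<Sum>j\<in>J. norm (F j w) powr p)"
  shows "\<exists>r>0. ball w r \<subseteq> V \<and>
    (\<forall>z\<in>ball w r. (\<Sum>j\<in>J. norm (F j z) powr p) = (\<Sum>j\<in>J. norm (F j w) powr p))"
proof -
  define J' where "J' = {j\<in>J. F j w \<noteq> 0}"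
  have J': "J' \<subseteq> J" "finite J'" using \<open>finite J\<close> by (auto simp: J'_def)
  have opn: "open (V \<inter> (\<Inter>j\<in>J'. {z\<in>V. F j z \<noteq> 0}))"
  proof (intro open_Int \<open>open V\<close> open_INT ballI \<open>finite J'\<close>)
    fix j assume "j \<in> J'"
    then have "continuous_on V (F j)"
      using hol J' holomorphic_on_imp_continuous_on by blast
    from continuous_open_preimage[OF this \<open>open V\<close>, of "- {0}"]
    show "open {z\<in>V. F j z \<noteq> 0}" 
      by (simp add: vimage_def Int_def open_Compl)
  qed
  moreover have "w \<in> V \<inter> (\<Inter>j\<in>J'. {z\<in>V. F j z \<noteq> 0})" 
    using \<open>w \<in> V\<close> by (auto simp: J'_def)
  ultimately obtain r where r: "r > 0" "ball w r \<subseteq> V \<inter> (\<Inter>j\<in>J'. {z\<in>V. F j z \<noteq> 0})"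
    using openE by blast
  have "\<exists>L. L holomorphic_on ball w r \<and> (\<forall>z\<in>ball w r. exp (L z) = F j z)" if "j \<in> J'" for j
  proof (rule holomorphic_logarithm_exists[of "ball w r" "F j" w])
    show "F j holomorphic_on ball w r"
      using hol[of j] J' that r(2) holomorphic_on_subset by blast
  qed (use r that in auto)
  then obtain L where L: "\<And>j. j \<in> J' \<Longrightarrow> L j holomorphic_on ball w r"
      "\<And>j z. j \<in> J' \<Longrightarrow> z \<in> ball w r \<Longrightarrow> exp (L j z) = F j z" by metis
  \<comment> \<open>The factor \<open>cis\<close> makes each summand positive at \<open>w\<close>.\<close>
  define H where "H = (\<lambda>z. \<Sum>j\<in>J'. cis (- p * Im (L j w)) * exp (of_real p * L j z))"
  have nrm: "norm (exp (of_real p * L j z)) = norm (F j z) powr p" if "j \<in> J'" "z \<in> ball w r" for j z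
    using L(2)[OF that, symmetric] by (simp add: powr_def)
  have Hle: "norm (H z) \<le> (\<Sum>j\<in>J. norm (F j z) powr p)" if "z \<in> ball w r" for z
  proof -
    have "norm (H z) \<le> (\<Sum>j\<in>J'. norm (F j z) powr p)"
      unfolding H_def by (rule order.trans[OF norm_sum], rule sum_mono) (simp only: norm_mult norm_cis nrm[OF _ that] mult_1_left order.refl)
    also have "\<dots> \<le> (\<Sum>j\<in>J. norm (F j z) powr p)"
      by (rule sum_mono2) (use J' \<open>finite J\<close> in auto)
    finally show ?thesis .
  qed
  have "H w = (\<Sum>j\<in>J'. of_real (norm (F j w) powr p))"
    unfolding H_def
  proof (rule sum.cong)
    fix j assume j: "j \<in> J'"
    let ?X = "of_real p * L j w"
    have "cis (- p * Im (L j w)) * exp ?X = of_real (exp (Re ?X)) * (cis (- p * Im (L j w)) * cis (Im ?X))"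
      by (subst exp_eq_polar) (simp only: mult_ac)
    also have "cis (- p * Im (L j w)) * cis (Im ?X) = 1"
      by (simp add: cis_mult)
    also have "exp (Re ?X) = norm (F j w) powr p"
      using nrm[OF j, of w] r(1) by (simp only: norm_exp_eq_Re centre_in_ball)
    finally show "cis (- p * Im (L j w)) * exp ?X = of_real (norm (F j w) powr p)"
      by (simp only: mult_1_right)
  qed auto
  also have "\<dots> = of_real (\<Sum>j\<in>J. norm (F j w) powr p)"
    unfolding of_real_sum using \<open>finite J\<close> by (intro sum.mono_neutral_left) (auto simp: J'_def)
  finally have Hw: "H w = of_real (\<Sum>j\<in>J. norm (F j w) powr p)" .
  have S0: "0 \<le> (\<Sum>j\<in>J. norm (F j w) powr p)" by (intro sum_nonneg) auto
  have nHw: "norm (H w) = (\<Sum>j\<in>J. norm (F j w) powr p)"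
    by (simp only: Hw norm_of_real abs_of_nonneg[OF S0])
  have "H holomorphic_on ball w r" unfolding H_def using L(1) by (intro holomorphic_intros) auto
  then have "H constant_on ball w r"
  proof (rule maximum_modulus_principle[where U="ball w r" and \<xi>=w])
    fix z assume z: "z \<in> ball w r"
    show "norm (H z) \<le> norm (H w)"
      unfolding nHw using order.trans[OF Hle[OF z] le] z r(2) by blast
  qed (use r in auto)
  then have const: "H z = H w" if "z \<in> ball w r" for z
    using that r(1) unfolding constant_on_def by (metis centre_in_ball)
  show ?thesis
  proof (intro exI[of _ r] conjI ballI)
    fix z assume z: "z \<in> ball w r"
    show "(\<Sum>j\<in>J. norm (F j z) powr p) = (\<Sum>j\<in>J. norm (F j w) powr p)"
    proof (rule antisym)
      show "(\<Sum>j\<in>J. norm (F j z) powr p) \<le> (\<Sum>j\<in>J. norm (F j w) powr p)"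
        using le z r(2) by blast
      show "(\<Sum>j\<in>J. norm (F j w) powr p) \<le> (\<Sum>j\<in>J. norm (F j z) powr p)"
        using Hle[OF z] unfolding const[OF z] nHw .
    qed
  qed (use r in auto)
qed

text \<open>
Among the maximum points of the sum in \<open>K\<close> choose one with the largest real part. The sum is constant near an
interior maximum point, so this one lies on the frontier.
\<close>

lemma powr_sum_maximum_principle:
  fixes F :: "'i \<Rightarrow> complex \<Rightarrow> complex"
  assumes "finite J" "0 < p" "compact K" "open V" "K \<subseteq> V"
    and hol: "\<And>j. j \<in> J \<Longrightarrow> F j holomorphic_on V"
    and bd: "\<And>w. w \<in> frontier K \<Longrightarrow> (\<Sum>j\<in>J. norm (F j w) powr p) \<le> B"
    and "z \<in> K"
  shows "(\<Sum>j\<in>J. norm (F j z) powr p) \<le> B"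
proof -
  define S where "S = (\<lambda>z. \<Sum>j\<in>J. norm (F j z) powr p)"
  have cont: "continuous_on K S" 
    unfolding S_def
  proof (intro continuous_on_sum continuous_on_powr' continuous_on_norm continuous_on_const ballI)
    fix j assume "j \<in> J"
    show "continuous_on K (F j)"
      using continuous_on_subset[OF holomorphic_on_imp_continuous_on[OF hol[OF \<open>j \<in> J\<close>]] \<open>K \<subseteq> V\<close>] .
  qed (use \<open>0 < p\<close> in auto)
  obtain w0 where w0: "w0 \<in> K" "\<And>z. z \<in> K \<Longrightarrow> S z \<le> S w0"
    using continuous_attains_sup[OF \<open>compact K\<close> _ cont] \<open>z \<in> K\<close> by auto
  define A where "A = {z\<in>K. S z = S w0}"
  have "compact A"
  proof -
    have "closedin (top_of_set K) (K \<inter> S -` {S w0})"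
      by (rule continuous_closedin_preimage[OF cont]) auto
    moreover have "K \<inter> S -` {S w0} = A" by (auto simp: A_def)
    ultimately show ?thesis using closedin_compact \<open>compact K\<close> by metis
  qed
  moreover have "w0 \<in> A" using w0(1) by (simp add: A_def)
  moreover have "continuous_on A Re" by (intro continuous_intros)
  ultimately obtain w where w: "w \<in> A" "\<And>z. z \<in> A \<Longrightarrow> Re z \<le> Re w"
    using continuous_attains_sup[of A Re] by blast
  have "w \<notin> interior K"
  proof
    assume wi: "w \<in> interior K"
    have Sw: "S w = S w0" using w(1) by (simp add: A_def)
    have "\<exists>r>0. ball w r \<subseteq> interior K \<and>
        (\<forall>z\<in>ball w r. (\<Sum>j\<in>J. norm (F j z) powr p) = (\<Sum>j\<in>J. norm (F j w) powr p))"
    proof (rule powr_sum_local_max_const[OF assms(1,2) open_interior wi])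
      show "F j holomorphic_on interior K" if "j \<in> J" for j
        using holomorphic_on_subset[OF hol[OF that] subset_trans[OF interior_subset \<open>K \<subseteq> V\<close>]] .
      show "(\<Sum>j\<in>J. norm (F j z) powr p) \<le> (\<Sum>j\<in>J. norm (F j w) powr p)" if "z \<in> interior K" for z
        using w0(2)[of z] subsetD[OF interior_subset that] Sw unfolding S_def by simp
    qed
    then obtain r where r: "r > 0" "ball w r \<subseteq> interior K" "\<And>z. z \<in> ball w r \<Longrightarrow> S z = S w"
      unfolding S_def by blast
    have "w + of_real (r/2) \<in> ball w r" using r(1) by (simp add: dist_norm)
    then have "w + of_real (r/2) \<in> A"
      using subsetD[OF interior_subset subsetD[OF r(2)]] r(3) Sw unfolding A_def by simp
    from w(2)[OF this] r(1) show False by simp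
  qed
  then have "w \<in> frontier K"
    using w(1) subsetD[OF closure_subset, of w K] unfolding frontier_def A_def by simp
  then have "S w \<le> B" using bd unfolding S_def by blast
  then show ?thesis using w0(2)[OF \<open>z \<in> K\<close>] w(1) unfolding A_def S_def by auto
qed

text \<open>
The error depends on \<open>\<phi>\<close> only through its oscillation \<open>e\<close> at distance \<open>h\<close>. It is therefore uniform for a
family of functions that is equicontinuous.
\<close>

lemma left_riemann_sum_error:
  fixes \<phi> :: "real \<Rightarrow> real"
  assumes "0 \<le> h" "continuous_on {a..a + real n * h} \<phi>"
    and osc: "\<And>s t. s \<in> {a..a + real n * h} \<Longrightarrow> t \<in> {a..a + real n * h} \<Longrightarrow> \<bar>s - t\<bar> \<le> h \<Longrightarrow> \<bar>\<phi> s - \<phi> t\<bar> \<le> e"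
  shows "\<bar>integral {a..a + real n * h} \<phi> - (\<Sum>j<n. h * \<phi> (a + real j * h))\<bar> \<le> real n * h * e"
  using assms(2,3)
proof (induction n)
  case 0
  then show ?case by simp
next
  case (Suc n)
  let ?c = "a + real n * h" and ?d = "a + real (Suc n) * h"
  have "0 \<le> real n * h" using \<open>0 \<le> h\<close> by simp
  then have cd: "a \<le> ?c" "?c \<le> ?d" "?d = ?c + h" using \<open>0 \<le> h\<close> by (auto simp: algebra_simps)
  have c1: "continuous_on {a..?c} \<phi>" and c2: "continuous_on {?c..?d} \<phi>"
    by (rule continuous_on_subset[OF Suc.prems(1)], use cd(1,2) in simp)+
  have 1: "\<bar>integral {a..?c} \<phi> - (\<Sum>j<n. h * \<phi> (a + real j * h))\<bar> \<le> real n * h * e"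
    using Suc.IH[OF c1] Suc.prems(2) cd by force
  have "norm (integral {?c..?d} (\<lambda>t. \<phi> t - \<phi> ?c)) \<le> e * (?d - ?c)"
  proof (rule integral_bound)
    show "?c \<le> ?d" by (rule cd(2))
    show "continuous_on {?c..?d} (\<lambda>t. \<phi> t - \<phi> ?c)"
      by (intro continuous_on_diff c2 continuous_on_const)
    fix t assume t: "t \<in> {?c..?d}"
    have "\<bar>\<phi> t - \<phi> ?c\<bar> \<le> e"
      using t cd order.trans[OF cd(1), of t] by (intro Suc.prems(2)) auto
    then show "norm (\<phi> t - \<phi> ?c) \<le> e" by simp
  qed
  moreover have "integral {?c..?d} (\<lambda>t. \<phi> t - \<phi> ?c) = integral {?c..?d} \<phi> - h * \<phi> ?c"
  proof -
    have "integral {?c..?d} (\<lambda>t. \<phi> t - \<phi> ?c) = integral {?c..?d} \<phi> - integral {?c..?d} (\<lambda>t. \<phi> ?c)"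
      by (intro integral_diff integrable_continuous_real c2 continuous_on_const)
    also have "integral {?c..?d} (\<lambda>t. \<phi> ?c) = h * \<phi> ?c"
      using cd(2,3) by simp
    finally show ?thesis .
  qed
  ultimately have 2: "\<bar>integral {?c..?d} \<phi> - h * \<phi> ?c\<bar> \<le> h * e"
    using cd(3) by (simp only: real_norm_def mult.commute add_diff_cancel_left')
  have 3: "integral {a..?c} \<phi> + integral {?c..?d} \<phi> = integral {a..?d} \<phi>"
    using cd Suc.prems(1) by (intro Henstock_Kurzweil_Integration.integral_combine integrable_continuous_real) auto
  show ?case
    unfolding 3[symmetric] using 1 2 by (simp add: algebra_simps)
qed

definition window_integral :: "real \<Rightarrow> real \<Rightarrow> (complex \<Rightarrow> complex) \<Rightarrow> complex \<Rightarrow> real" where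
  "window_integral p N f z = integral {-N..N} (\<lambda>t. norm (f (z + of_real t)) powr p)"

text \<open>
For continuous \<open>U\<close> this expresses that \<open>ln U\<close> is subharmonic: adding the harmonic function \<open>Re g\<close> does not
destroy the maximum principle. The multiplicative form admits zeros of \<open>U\<close>.
\<close>

definition log_maximum_principle :: "(complex \<Rightarrow> real) \<Rightarrow> bool" where
  "log_maximum_principle U \<longleftrightarrow>
    (\<forall>K V g B. compact K \<longrightarrow> open V \<longrightarrow> K \<subseteq> V \<longrightarrow> g holomorphic_on V \<longrightarrow>
      (\<forall>w\<in>frontier K. U w * exp (Re (g w)) \<le> B) \<longrightarrow> (\<forall>z\<in>K. U z * exp (Re (g z)) \<le> B))"

lemma log_maximum_principleD:
  assumes "log_maximum_principle U" "compact K" "open V" "K \<subseteq> V" "g holomorphic_on V"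
    and "\<And>w. w \<in> frontier K \<Longrightarrow> U w * exp (Re (g w)) \<le> B" "z \<in> K"
  shows "U z * exp (Re (g z)) \<le> B"
  using assms unfolding log_maximum_principle_def by blast

lemma log_maximum_principle_mult_exp:
  assumes "log_maximum_principle U" "k holomorphic_on UNIV"
  shows "log_maximum_principle (\<lambda>z. U z * exp (Re (k z)))"
  unfolding log_maximum_principle_def
proof (intro allI impI)
  fix K V g B
  assume K: "compact K" "open V" "K \<subseteq> V" and g: "g holomorphic_on V"
    and bd: "\<forall>w\<in>frontier K. U w * exp (Re (k w)) * exp (Re (g w)) \<le> B"
  have "(\<lambda>z. k z + g z) holomorphic_on V"
    using g assms(2) holomorphic_on_subset by (auto intro!: holomorphic_intros)
  from log_maximum_principleD[OF assms(1) K this, of B] bd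
  show "\<forall>z\<in>K. U z * exp (Re (k z)) * exp (Re (g z)) \<le> B"
    by (simp add: exp_add mult.assoc)
qed

text \<open>
On a compact \<open>K\<close> the function \<open>\<bar>f (z + t) exp (g z / p)\<bar> ^ p\<close> is uniformly continuous in \<open>(z, t)\<close>. Hence
Riemann sums approximate its integral in \<open>t\<close> uniformly on \<open>K\<close>, and each of them is a finite sum of
\<open>p\<close>-th powers of moduli of holomorphic functions.
\<close>

lemma log_maximum_principle_window_integral:
  assumes f: "f holomorphic_on UNIV" and "0 < p" "0 < N"
  shows "log_maximum_principle (window_integral p N f)"
  unfolding log_maximum_principle_def
proof (intro allI impI ballI)
  fix K V g B z
  assume K: "compact K" "open V" "K \<subseteq> V" and g: "g holomorphic_on V"
    and bd: "\<forall>w\<in>frontier K. window_integral p N f w * exp (Re (g w)) \<le> B" and "z \<in> K"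
  define \<Phi> where "\<Phi> = (\<lambda>(z, t). norm (f (z + of_real t) * exp (g z / of_real p)) powr p)"
  have contf: "continuous_on UNIV f" using f holomorphic_on_imp_continuous_on by blast
  have contg: "continuous_on K g" using g K holomorphic_on_imp_continuous_on continuous_on_subset by blast
  have "continuous_on (K \<times> {-N..N}) \<Phi>"
    unfolding \<Phi>_def case_prod_unfold using \<open>0 < p\<close>
    by (intro continuous_on_powr' continuous_intros continuous_on_compose2[OF contf] continuous_on_compose2[OF contg]) auto
  then have unif: "uniformly_continuous_on (K \<times> {-N..N}) \<Phi>"
    by (intro compact_uniformly_continuous compact_Times K) auto
  have intg: "integral {-N..N} (\<lambda>t. \<Phi> (w, t)) = window_integral p N f w * exp (Re (g w))" for w
    using \<open>0 < p\<close>
    by (simp add: \<Phi>_def window_integral_def norm_mult powr_mult exp_powr_real)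
  show "window_integral p N f z * exp (Re (g z)) \<le> B"
  proof (rule field_le_epsilon)
    fix e :: real assume "e > 0"
    define e' where "e' = e / (4 * N)"
    have "e' > 0" using \<open>e > 0\<close> \<open>0 < N\<close> by (simp add: e'_def)
    then obtain \<delta> where \<delta>: "\<delta> > 0" "\<And>x y. x \<in> K \<times> {-N..N} \<Longrightarrow> y \<in> K \<times> {-N..N} \<Longrightarrow> dist y x < \<delta> \<Longrightarrow> dist (\<Phi> y) (\<Phi> x) < e'"
      using unif unfolding uniformly_continuous_on_def by metis
    obtain n :: nat where n: "2 * N / \<delta> < real n" using reals_Archimedean2 by blast
    then have "n > 0" using \<delta> \<open>0 < N\<close> by (auto intro: gr0I simp: divide_less_0_iff)
    define h where "h = 2 * N / real n"
    have h: "h > 0" "real n * h = 2 * N" "h < \<delta>" 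
      using \<open>0 < N\<close> \<open>n > 0\<close> n \<delta>(1) by (auto simp: h_def field_simps)
    define S where "S = (\<lambda>w. \<Sum>j<n. h * \<Phi> (w, -N + real j * h))"
    have err: "\<bar>window_integral p N f w * exp (Re (g w)) - S w\<bar> \<le> e / 2" if "w \<in> K" for w
    proof -
      have eq: "-N + real n * h = N" using h by simp
      have "continuous_on {-N..N} (\<lambda>t. \<Phi> (w, t))"
        using \<open>continuous_on (K \<times> {-N..N}) \<Phi>\<close> by (rule continuous_on_compose2) (use that in \<open>auto intro!: continuous_intros\<close>)
      moreover have "\<bar>\<Phi> (w, s) - \<Phi> (w, t)\<bar> \<le> e'" if "s \<in> {-N..N}" "t \<in> {-N..N}" "\<bar>s - t\<bar> \<le> h" for s t
        using \<delta>(2)[of "(w,t)" "(w,s)"] that \<open>w \<in> K\<close> h(3) by (auto simp: dist_Pair_Pair dist_real_def)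
      ultimately have "\<bar>integral {-N..N} (\<lambda>t. \<Phi> (w, t)) - S w\<bar> \<le> real n * h * e'"
        using left_riemann_sum_error[of h "-N" n "\<lambda>t. \<Phi> (w, t)" e'] h(1) unfolding eq S_def by auto
      then show ?thesis using h(2) \<open>0 < N\<close> unfolding intg by (simp add: e'_def)
    qed
    \<comment> \<open>The step width \<open>h\<close> is moved inside the \<open>p\<close>-th power.\<close>
    define F where "F = (\<lambda>j w. of_real (h powr (1/p)) * (f (w + of_real (-N + real j * h)) * exp (g w / of_real p)))"
    have SF: "S w = (\<Sum>j<n. norm (F j w) powr p)" for w
      unfolding S_def F_def \<Phi>_def using h(1) \<open>0 < p\<close>
      by (intro sum.cong) (auto simp: norm_mult powr_mult powr_powr abs_mult)
    have "(\<Sum>j<n. norm (F j z) powr p) \<le> B + e/2"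
    proof (rule powr_sum_maximum_principle[OF _ \<open>0 < p\<close> K(1) K(2) K(3) _ _ \<open>z \<in> K\<close>])
      show "F j holomorphic_on V" for j
        unfolding F_def using \<open>0 < p\<close>
        by (intro holomorphic_intros holomorphic_on_compose_gen[OF _ f, unfolded o_def] g) auto
      fix w assume w: "w \<in> frontier K"
      then have "w \<in> K" using K(1) compact_imp_closed frontier_subset_closed by blast
      then show "(\<Sum>j<n. norm (F j w) powr p) \<le> B + e/2"
        using err[OF \<open>w \<in> K\<close>] bspec[OF bd w] unfolding SF[symmetric] by linarith
    qed auto
    then show "window_integral p N f z * exp (Re (g z)) \<le> B + e"
      using err[OF \<open>z \<in> K\<close>] unfolding SF[symmetric] by linarith
  qed
qed

section \<open>Phragmen-Lindelof principles\<close>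

text \<open>
The hypothesis places \<open>w\<close> in the sector of half-angle \<open>\<pi>/8\<close>, so that \<open>w ^ 3\<close> has argument at most
\<open>3 \<pi>/8\<close> in modulus.
\<close>

lemma Re_cube_ge:
  fixes w :: complex
  assumes "0 \<le> Re w" "\<bar>Im (w\<^sup>2)\<bar> \<le> Re (w\<^sup>2)"
  shows "norm w ^ 3 / 32 \<le> Re (w ^ 3)"
proof -
  define a b where "a = Re w" and "b = \<bar>Im w\<bar>"
  have ab: "a \<ge> 0" "b \<ge> 0" by (simp_all add: a_def b_def assms)
  have *: "b\<^sup>2 + 2*a*b \<le> a\<^sup>2"
    using assms(2) by (simp add: a_def b_def power2_eq_square abs_mult assms(1) algebra_simps)
  have "b \<le> a/2"
  proof (rule ccontr)
    assume "\<not> b \<le> a/2"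
    then have "b > a/2" by simp
    then have "b * b > 0" using ab by (intro mult_pos_pos) auto
    moreover have "a * a \<le> a * (2 * b)" using \<open>b > a/2\<close> ab by (intro mult_left_mono) auto
    ultimately show False using * unfolding power2_eq_square by linarith
  qed
  then have b2: "b\<^sup>2 \<le> (a/2)\<^sup>2" using ab by (intro power_mono)
  have "norm w \<le> \<bar>Re w\<bar> + \<bar>Im w\<bar>" by (rule cmod_le)
  then have "norm w \<le> 2 * a" using \<open>b \<le> a/2\<close> ab by (simp add: a_def b_def)
  then have "norm w ^ 3 \<le> (2*a)^3" by (intro power_mono) auto
  moreover have "Re (w^3) = a * (a\<^sup>2 - 3 * b\<^sup>2)"
    by (simp add: a_def b_def power3_eq_cube power2_eq_square algebra_simps)
  moreover have "a * (a\<^sup>2/4) \<le> a * (a\<^sup>2 - 3 * b\<^sup>2)"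
    using b2 ab by (intro mult_left_mono) (auto simp: power_divide)
  ultimately show ?thesis by (simp add: power3_eq_cube power2_eq_square)
qed

text \<open>
The sector has opening \<open>\<pi>/2\<close> and bisector \<open>u\<close>. Functions of order \<open>1\<close> are small compared with
\<open>exp (\<eta> (w cnj u) powr (3/2))\<close>, whose exponent still has positive real part on the sector. Divide by it, apply
the maximum principle on a large bounded piece of the sector, and let \<open>\<eta>\<close> tend to \<open>0\<close>.
\<close>

lemma phragmen_lindelof_right_angle:
  fixes U :: "complex \<Rightarrow> real" and u :: complex
  assumes U: "log_maximum_principle U" "\<And>z. 0 \<le> U z"
    and growth: "\<And>z. U z \<le> A * exp (k * norm z)" and "0 \<le> k"
    and bd: "\<And>z. \<bar>Im (z * cnj u)\<bar> = Re (z * cnj u) \<Longrightarrow> U z \<le> B"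
    and "0 < B" "1 \<le> norm u" and z: "\<bar>Im (z * cnj u)\<bar> \<le> Re (z * cnj u)"
  shows "U z \<le> B"
proof -
  \<comment> \<open>The shift by \<open>1\<close> removes the branch point \<open>0\<close> from the closed sector.\<close>
  define c where "c = (\<lambda>w. csqrt (w * cnj u + 1))"
  have A: "0 \<le> A" using growth[of 0] U(2)[of 0] by simp
  have weighted: "U z \<le> B * exp (\<eta> * Re (c z ^ 3))" if "\<eta> > 0" for \<eta>
  proof -
    \<comment> \<open>The three entries put \<open>z\<close> inside the arc, beat the constant \<open>A\<close>, and beat the growth rate \<open>k\<close>.\<close>
    define R where "R = Max {norm z, A / B, (32 * (k + 1) / \<eta>)\<^sup>2}"
    have R: "norm z \<le> R" "A / B \<le> R" "(32 * (k + 1) / \<eta>)\<^sup>2 \<le> R" by (auto simp: R_def)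
    have "R \<ge> 0" using R(1) norm_ge_zero order.trans by blast
    define K where "K = {w. \<bar>Im (w * cnj u)\<bar> \<le> Re (w * cnj u)} \<inter> cball 0 R"
    define V where "V = {w. Re (w * cnj u + 1) > 0}"
    have clos: "closed {w. \<bar>Im (w * cnj u)\<bar> \<le> Re (w * cnj u)}"
      by (intro closed_Collect_le continuous_intros)
    then have "compact K" unfolding K_def by (rule closed_Int_compact) simp
    have "open V" unfolding V_def by (intro open_Collect_less continuous_intros)
    have "K \<subseteq> V" unfolding K_def V_def by auto
    have hol: "(\<lambda>w. - of_real \<eta> * c w ^ 3) holomorphic_on V"
      unfolding c_def by (intro holomorphic_intros) (auto simp: V_def complex_nonpos_Reals_iff)
    have Rec: "norm w * sqrt (norm w) / 32 \<le> Re (c w ^ 3)" if "\<bar>Im (w * cnj u)\<bar> \<le> Re (w * cnj u)" for w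
    proof -
      have "norm w * 1 \<le> norm w * norm u" using \<open>1 \<le> norm u\<close> by (intro mult_left_mono) auto
      also have "\<dots> = norm (w * cnj u)" by (simp add: norm_mult)
      also have "\<dots> \<le> norm (w * cnj u + 1)"
        unfolding cmod_def using that by (intro real_sqrt_le_mono) (auto simp: power2_eq_square algebra_simps)
      finally have n: "norm w \<le> norm (w * cnj u + 1)" by simp
      have "norm w * sqrt (norm w) \<le> norm (w * cnj u + 1) * sqrt (norm (w * cnj u + 1))"
        using n by (intro mult_mono) auto
      also have "\<dots> = norm (c w) ^ 3"
        by (simp add: c_def power3_eq_cube)
      also have "\<dots> / 32 \<le> Re (c w ^ 3)"
      proof (rule Re_cube_ge)
        show "0 \<le> Re (c w)" unfolding c_def by (rule Re_csqrt)
        show "\<bar>Im ((c w)\<^sup>2)\<bar> \<le> Re ((c w)\<^sup>2)" using that unfolding c_def by simp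
      qed
      finally show ?thesis by simp
    qed
    have "U z * exp (Re (- of_real \<eta> * c z ^ 3)) \<le> B"
    proof (rule log_maximum_principleD[OF U(1) \<open>compact K\<close> \<open>open V\<close> \<open>K \<subseteq> V\<close> hol])
      show "z \<in> K" using z R(1) by (simp add: K_def)
      fix w assume w: "w \<in> frontier K"
      then have "w \<in> K" using \<open>compact K\<close> compact_imp_closed frontier_subset_closed by blast
      then have wK: "\<bar>Im (w * cnj u)\<bar> \<le> Re (w * cnj u)" "norm w \<le> R" by (auto simp: K_def)
      have "0 \<le> norm w * sqrt (norm w) / 32" by simp
      then have nonneg: "0 \<le> Re (c w ^ 3)" using Rec[OF wK(1)] by linarith
      consider "\<bar>Im (w * cnj u)\<bar> = Re (w * cnj u)" | "norm w = R"
      proof (rule ccontr)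
        assume "\<not> thesis"
        with that wK have lt: "\<bar>Im (w * cnj u)\<bar> < Re (w * cnj u)" "norm w < R" by fastforce+
        have "open ({w. \<bar>Im (w * cnj u)\<bar> < Re (w * cnj u)} \<inter> ball 0 R)"
          by (intro open_Int open_Collect_less continuous_intros) auto
        moreover have "\<dots> \<subseteq> K" by (auto simp: K_def)
        ultimately have "w \<in> interior K" using lt by (auto intro!: interiorI)
        then show False using w by (simp add: frontier_def)
      qed
      then show "U w * exp (Re (- of_real \<eta> * c w ^ 3)) \<le> B"
      proof cases
        case 1
        have "U w * exp (Re (- of_real \<eta> * c w ^ 3)) \<le> U w * 1"
          using nonneg \<open>\<eta> > 0\<close> U(2) by (intro mult_left_mono) auto
        then show ?thesis using bd[OF 1] by simp
      next
        case 2
        have "sqrt ((32 * (k + 1) / \<eta>)\<^sup>2) \<le> sqrt R" using R(3) by (rule real_sqrt_le_mono)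
        then have "32 * (k + 1) / \<eta> \<le> sqrt R" using \<open>\<eta> > 0\<close> \<open>0 \<le> k\<close> by simp
        then have "k + 1 \<le> \<eta> * sqrt R / 32" using \<open>\<eta> > 0\<close> by (simp add: field_simps)
        then have "R * (k + 1) \<le> R * (\<eta> * sqrt R / 32)" using \<open>R \<ge> 0\<close> by (intro mult_left_mono)
        also have "\<dots> = \<eta> * (norm w * sqrt (norm w) / 32)" by (simp add: 2)
        also have "\<dots> \<le> \<eta> * Re (c w ^ 3)" using Rec[OF wK(1)] \<open>\<eta> > 0\<close> by (intro mult_left_mono) auto
        finally have e: "k * R - \<eta> * Re (c w ^ 3) \<le> - R" by (simp add: algebra_simps)
        have "U w * exp (Re (- of_real \<eta> * c w ^ 3)) \<le> A * exp (k * R) * exp (- (\<eta> * Re (c w ^ 3)))"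
          using growth[of w] 2 A by (intro mult_mono) auto
        also have "\<dots> = A * exp (k * R - \<eta> * Re (c w ^ 3))" by (simp add: exp_diff exp_minus divide_inverse)
        also have "\<dots> \<le> A * exp (- R)" using e A by (intro mult_left_mono) auto
        also have "\<dots> \<le> B"
        proof -
          have "A \<le> B * R" using R(2) \<open>0 < B\<close> by (simp add: field_simps)
          also have "\<dots> \<le> B * exp R" using order.trans[OF _ exp_ge_add_one_self, of R R] \<open>0 < B\<close> by (intro mult_left_mono) auto
          finally show ?thesis by (simp add: exp_minus field_simps)
        qed
        finally show ?thesis .
      qed
    qed
    then show ?thesis by (simp add: exp_minus field_simps)
  qed
  have "((\<lambda>\<eta>. B * exp (\<eta> * Re (c z ^ 3))) \<longlongrightarrow> B * exp (0 * Re (c z ^ 3))) (at_right 0)"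
    by (intro tendsto_intros)
  moreover have "eventually (\<lambda>\<eta>. U z \<le> B * exp (\<eta> * Re (c z ^ 3))) (at_right 0)"
    using eventually_mono[OF eventually_at_right_less weighted] .
  ultimately have "U z \<le> B * exp (0 * Re (c z ^ 3))"
    by (intro tendsto_lowerbound) auto
  then show ?thesis by simp
qed

text \<open>
As \<open>U\<close> is bounded, the slowly decaying weight \<open>\<bar>1 - \<i> w\<bar> powr (- \<eta>)\<close> makes it small on large half
circles. Again \<open>\<eta>\<close> tends to \<open>0\<close>.
\<close>

lemma phragmen_lindelof_half_plane:
  fixes U :: "complex \<Rightarrow> real"
  assumes U: "log_maximum_principle U" "\<And>z. 0 \<le> U z"
    and growth: "\<And>z. 0 \<le> Im z \<Longrightarrow> U z \<le> A"
    and bd: "\<And>z. Im z = 0 \<Longrightarrow> U z \<le> B"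
    and "0 < B" and z: "0 \<le> Im z"
  shows "U z \<le> B"
proof -
  have A: "0 \<le> A" using growth[of 0] U(2)[of 0] by simp
  have weighted: "U z \<le> B * exp (\<eta> * ln (norm (1 - \<i> * z)))" if "\<eta> > 0" for \<eta>
  proof -
    define R where "R = max (norm z) (exp (A / (B * \<eta>)))"
    have R: "norm z \<le> R" "exp (A / (B * \<eta>)) \<le> R" by (auto simp: R_def)
    have "R > 0" using R(2) exp_gt_zero less_le_trans by blast
    define K where "K = {w. 0 \<le> Im w} \<inter> cball 0 R"
    define V where "V = {w. Re (1 - \<i> * w) > 0}"
    have "compact K" unfolding K_def by (intro closed_Int_compact closed_halfspace_Im_ge compact_cball)
    have "open V" unfolding V_def by (intro open_Collect_less continuous_intros)
    have "K \<subseteq> V" unfolding K_def V_def by auto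
    have hol: "(\<lambda>w. - of_real \<eta> * Ln (1 - \<i> * w)) holomorphic_on V"
      by (intro holomorphic_intros) (auto simp: V_def complex_nonpos_Reals_iff)
    have Re_g: "Re (- of_real \<eta> * Ln (1 - \<i> * w)) = - (\<eta> * ln (norm (1 - \<i> * w)))" if "0 \<le> Im w" for w
    proof -
      have "Re (1 - \<i> * w) \<noteq> Re 0" using that by simp
      then have "1 - \<i> * w \<noteq> 0" by metis
      then show ?thesis by simp
    qed
    have ge1: "1 \<le> norm (1 - \<i> * w)" if "0 \<le> Im w" for w
      using complex_Re_le_cmod[of "1 - \<i> * w"] that by simp
    have geR: "norm w \<le> norm (1 - \<i> * w)" if "0 \<le> Im w" for w
      unfolding cmod_def using that by (intro real_sqrt_le_mono) (auto simp: power2_eq_square algebra_simps)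
    have "U z * exp (Re (- of_real \<eta> * Ln (1 - \<i> * z))) \<le> B"
    proof (rule log_maximum_principleD[OF U(1) \<open>compact K\<close> \<open>open V\<close> \<open>K \<subseteq> V\<close> hol])
      show "z \<in> K" using z R(1) by (simp add: K_def)
      fix w assume w: "w \<in> frontier K"
      then have "w \<in> K" using \<open>compact K\<close> compact_imp_closed frontier_subset_closed by blast
      then have wK: "0 \<le> Im w" "norm w \<le> R" by (auto simp: K_def)
      consider "Im w = 0" | "norm w = R"
      proof (rule ccontr)
        assume "\<not> thesis"
        with that wK have lt: "0 < Im w" "norm w < R" by fastforce+
        have "open ({w. 0 < Im w} \<inter> ball 0 R)"
          by (intro open_Int open_halfspace_Im_gt open_ball)
        moreover have "\<dots> \<subseteq> K" by (auto simp: K_def)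
        ultimately have "w \<in> interior K" using lt by (auto intro!: interiorI)
        then show False using w by (simp add: frontier_def)
      qed
      then show "U w * exp (Re (- of_real \<eta> * Ln (1 - \<i> * w))) \<le> B"
      proof cases
        case 1
        have "U w * exp (Re (- of_real \<eta> * Ln (1 - \<i> * w))) \<le> U w * 1"
          unfolding Re_g[OF wK(1)] using ge1[OF wK(1)] \<open>\<eta> > 0\<close> U(2) by (intro mult_left_mono) auto
        then show ?thesis using bd[OF 1] by simp
      next
        case 2
        have "A / (B * \<eta>) \<le> ln R" using R(2) \<open>R > 0\<close> by (simp add: ln_ge_iff)
        also have "\<dots> \<le> ln (norm (1 - \<i> * w))" using geR[OF wK(1)] \<open>R > 0\<close> unfolding 2 by (subst ln_le_cancel_iff) auto
        finally have e: "A / B \<le> \<eta> * ln (norm (1 - \<i> * w))"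
          using \<open>\<eta> > 0\<close> \<open>0 < B\<close> by (simp add: field_simps)
        have "U w * exp (Re (- of_real \<eta> * Ln (1 - \<i> * w))) \<le> A * exp (- (A / B))"
          unfolding Re_g[OF wK(1)] using growth[OF wK(1)] e A by (intro mult_mono) auto
        also have "\<dots> \<le> B"
        proof -
          have "A = B * (A / B)" using \<open>0 < B\<close> by simp
          also have "\<dots> \<le> B * exp (A / B)" using order.trans[OF _ exp_ge_add_one_self, of "A / B" "A / B"] \<open>0 < B\<close> by (intro mult_left_mono) auto
          finally show ?thesis by (simp add: exp_minus field_simps)
        qed
        finally show ?thesis .
      qed
    qed
    then show ?thesis unfolding Re_g[OF z] by (simp add: exp_minus field_simps)
  qed
  have "((\<lambda>\<eta>. B * exp (\<eta> * ln (norm (1 - \<i> * z)))) \<longlongrightarrow> B * exp (0 * ln (norm (1 - \<i> * z)))) (at_right 0)"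
    by (intro tendsto_intros)
  moreover have "eventually (\<lambda>\<eta>. U z \<le> B * exp (\<eta> * ln (norm (1 - \<i> * z)))) (at_right 0)"
    using eventually_mono[OF eventually_at_right_less weighted] .
  ultimately have "U z \<le> B * exp (0 * ln (norm (1 - \<i> * z)))"
    by (intro tendsto_lowerbound) auto
  then show ?thesis by simp
qed

section \<open>The Plancherel-Polya inequality\<close>

lemma window_integral_nonneg: "0 \<le> window_integral p N f z"
  unfolding window_integral_def
  by (cases "(\<lambda>t. norm (f (z + of_real t)) powr p) integrable_on {-N..N}")
     (auto intro: integral_nonneg simp: not_integrable_integral)

text \<open>
The weight \<open>exp (- p \<tau> Im z)\<close> cancels the growth along the imaginary axis. So the weighted integral is bounded
on the boundaries of both quadrants of the upper half plane, hence on the half plane, and then by its bound \<open>M\<close>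
on the real axis. The constant \<open>C\<close> of the growth condition disappears in the last step.
\<close>

lemma window_integral_upper_half_plane:
  assumes f: "f holomorphic_on UNIV" and "0 < p" "0 < N" "0 \<le> \<tau>"
    and growth: "\<And>z. norm (f z) \<le> C * exp (\<tau> * norm z)"
    and real_bd: "\<And>x. window_integral p N f (of_real x) \<le> M" and "0 < M" and "0 \<le> Im z"
  shows "window_integral p N f z \<le> M * exp (p * \<tau> * Im z)"
proof -
  have C: "0 \<le> C" using growth[of 0] order.trans[OF norm_ge_zero] by fastforce
  define B where "B = 2 * N * (C * exp (\<tau> * N)) powr p"
  have "B \<ge> 0" using \<open>0 < N\<close> by (simp add: B_def)
  have contf: "continuous_on UNIV f" using f holomorphic_on_imp_continuous_on by blast
  have wm_bd: "window_integral p N f w \<le> B * exp (p * \<tau> * norm w)" for w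
  proof -
    have "norm (window_integral p N f w) \<le> (C * exp (\<tau> * (norm w + N))) powr p * (N - (- N))"
      unfolding window_integral_def
    proof (rule integral_bound)
      show "continuous_on {-N..N} (\<lambda>t. norm (f (w + of_real t)) powr p)"
        using \<open>0 < p\<close> by (intro continuous_on_powr' continuous_intros continuous_on_compose2[OF contf]) auto
      fix t assume t: "t \<in> {-N..N}"
      have "norm (w + of_real t) \<le> norm w + N"
        using norm_triangle_ineq[of w "of_real t"] t by (auto simp: abs_le_iff intro: order.trans)
      then have "C * exp (\<tau> * norm (w + of_real t)) \<le> C * exp (\<tau> * (norm w + N))"
        using C \<open>0 \<le> \<tau>\<close> by (intro mult_left_mono) (auto intro: mult_left_mono)
      then have "norm (f (w + of_real t)) \<le> C * exp (\<tau> * (norm w + N))"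
        using growth order.trans by blast
      then show "norm (norm (f (w + of_real t)) powr p) \<le> (C * exp (\<tau> * (norm w + N))) powr p"
        using \<open>0 < p\<close> by (simp add: powr_mono2)
    qed (use \<open>0 < N\<close> in simp)
    also have "C * exp (\<tau> * (norm w + N)) = (C * exp (\<tau> * N)) * exp (\<tau> * norm w)"
      by (simp add: exp_add algebra_simps)
    also have "\<dots> powr p = (C * exp (\<tau> * N)) powr p * exp (p * \<tau> * norm w)"
      using C by (simp add: powr_mult exp_powr_real mult_ac)
    finally show ?thesis
      unfolding B_def real_norm_def using abs_ge_self[of "window_integral p N f w"] by (simp add: mult_ac)
  qed
  define U where "U = (\<lambda>w. window_integral p N f w * exp (Re (\<i> * of_real (p * \<tau>) * w)))"
  have U: "log_maximum_principle U"
    unfolding U_def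
    by (intro log_maximum_principle_mult_exp log_maximum_principle_window_integral f \<open>0 < p\<close> \<open>0 < N\<close> holomorphic_intros)
  have U_eq: "U w = window_integral p N f w * exp (- (p * \<tau> * Im w))" for w
    by (simp add: U_def)
  have U0: "0 \<le> U w" for w unfolding U_eq using window_integral_nonneg[of p N f w] by simp
  have U_growth: "U w \<le> B * exp (2 * p * \<tau> * norm w)" for w
  proof -
    have "- (p * \<tau> * Im w) \<le> p * \<tau> * norm w"
      using mult_left_mono[of "- Im w" "norm w" "p * \<tau>"] abs_Im_le_cmod[of w] \<open>0 < p\<close> \<open>0 \<le> \<tau>\<close> by auto
    then have "U w \<le> B * exp (p * \<tau> * norm w) * exp (p * \<tau> * norm w)"
      unfolding U_eq using wm_bd[of w] \<open>B \<ge> 0\<close> by (intro mult_mono) auto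
    also have "\<dots> = B * exp (2 * p * \<tau> * norm w)" by (simp add: exp_add[symmetric])
    finally show ?thesis .
  qed
  have U_real: "U w \<le> M" if "Im w = 0" for w
    using real_bd[of "Re w"] that unfolding U_eq by (simp add: complex_eq_iff of_real_Re complex_is_Real_iff)
  \<comment> \<open>On the imaginary axis \<open>norm w = Im w\<close>, so growth and weight cancel.\<close>
  have U_imag: "U w \<le> B" if "Re w = 0" "0 \<le> Im w" for w
  proof -
    have "norm w = Im w" using that by (simp add: cmod_def)
    then show ?thesis using wm_bd[of w] unfolding U_eq by (simp add: exp_minus field_simps)
  qed
  have upper: "U w \<le> max M B" if "0 \<le> Im w" for w
  proof -
    have "0 < max M B" using \<open>0 < M\<close> by simp
    have k: "0 \<le> 2 * p * \<tau>" using \<open>0 < p\<close> \<open>0 \<le> \<tau>\<close> by simp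
    have n1: "1 \<le> norm (1 + \<i>)" "1 \<le> norm (-1 + \<i>)" by (simp_all add: cmod_def)
    show ?thesis
    proof (cases "0 \<le> Re w")
      case True
      show ?thesis
      proof (rule phragmen_lindelof_right_angle[OF U U0 U_growth k _ \<open>0 < max M B\<close> n1(1)])
        show "\<bar>Im (w * cnj (1 + \<i>))\<bar> \<le> Re (w * cnj (1 + \<i>))" using True that by auto
        fix v assume "\<bar>Im (v * cnj (1 + \<i>))\<bar> = Re (v * cnj (1 + \<i>))"
        then have "Im v = 0 \<or> Re v = 0 \<and> 0 \<le> Im v" by (auto simp: abs_if split: if_splits)
        then show "U v \<le> max M B" using U_real[of v] U_imag[of v] by linarith
      qed
    next
      case False
      show ?thesis
      proof (rule phragmen_lindelof_right_angle[OF U U0 U_growth k _ \<open>0 < max M B\<close> n1(2)])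
        show "\<bar>Im (w * cnj (-1 + \<i>))\<bar> \<le> Re (w * cnj (-1 + \<i>))" using False that by auto
        fix v assume "\<bar>Im (v * cnj (-1 + \<i>))\<bar> = Re (v * cnj (-1 + \<i>))"
        then have "Im v = 0 \<or> Re v = 0 \<and> 0 \<le> Im v" by (auto simp: abs_if split: if_splits)
        then show "U v \<le> max M B" using U_real[of v] U_imag[of v] by linarith
      qed
    qed
  qed
  have "U z \<le> M"
    by (rule phragmen_lindelof_half_plane[OF U U0 upper U_real \<open>0 < M\<close> \<open>0 \<le> Im z\<close>])
  then show ?thesis unfolding U_eq by (simp add: exp_minus field_simps)
qed

lemma window_integral_reflect: "window_integral p N (\<lambda>z. f (- z)) z = window_integral p N f (- z)"
proof -
  define g where "g = (\<lambda>s. norm (f (- z + of_real s)) powr p)"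
  have "window_integral p N (\<lambda>z. f (- z)) z = integral {-N..- (-N)} (\<lambda>t. g (- t))"
    unfolding window_integral_def g_def by (simp only: minus_add_distrib of_real_minus minus_minus)
  also have "\<dots> = integral {-N..N} g"
    by (rule Henstock_Kurzweil_Integration.integral_reflect_real)
  finally show ?thesis unfolding window_integral_def g_def .
qed

lemma window_integral_plane:
  assumes f: "f holomorphic_on UNIV" and "0 < p" "0 < N" "0 \<le> \<tau>"
    and growth: "\<And>z. norm (f z) \<le> C * exp (\<tau> * norm z)"
    and real_bd: "\<And>x. window_integral p N f (of_real x) \<le> M" and "0 < M"
  shows "window_integral p N f z \<le> M * exp (p * \<tau> * \<bar>Im z\<bar>)"
proof (cases "0 \<le> Im z")
  case True
  then show ?thesis using window_integral_upper_half_plane[OF assms True] by simp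
next
  case False
  have "window_integral p N (\<lambda>z. f (- z)) (- z) \<le> M * exp (p * \<tau> * Im (- z))"
  proof (rule window_integral_upper_half_plane[OF _ assms(2-4)])
    show "(\<lambda>z. f (- z)) holomorphic_on UNIV"
      by (intro holomorphic_on_compose_gen[OF _ f, unfolded o_def] holomorphic_intros) auto
    show "norm (f (- z)) \<le> C * exp (\<tau> * norm z)" for z using growth[of "- z"] by simp
    show "window_integral p N (\<lambda>z. f (- z)) (of_real x) \<le> M" for x
      using real_bd[of "- x"] unfolding window_integral_reflect by simp
  qed (use False \<open>0 < M\<close> in auto)
  then show ?thesis using False unfolding window_integral_reflect by simp
qed

lemma window_integral_eq_nn_integral:
  assumes f: "f holomorphic_on UNIV" and "0 < p"
  shows "ennreal (window_integral p N f z)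
    = (\<integral>\<^sup>+t. indicator {-N..N} t * ennreal (norm (f (z + of_real t)) powr p) \<partial>lborel)"
proof -
  have contf: "continuous_on UNIV f" using f holomorphic_on_imp_continuous_on by blast
  have cont: "continuous_on A (\<lambda>t. norm (f (z + of_real t)) powr p)" for A
    using \<open>0 < p\<close> by (intro continuous_on_powr' continuous_intros continuous_on_compose2[OF contf]) auto
  have "((\<lambda>t. norm (f (z + of_real t)) powr p) has_integral window_integral p N f z) {-N..N}"
    unfolding window_integral_def by (intro integrable_integral integrable_continuous_real cont)
  then have "(\<integral>\<^sup>+t. indicator {-N..N} t * norm (f (z + of_real t)) powr p \<partial>lborel) = ennreal (window_integral p N f z)"
    by (intro nn_integral_has_integral_lebesgue) auto
  moreover have "ennreal (indicator {-N..N} t * r) = indicator {-N..N} t * ennreal r" for t r :: real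
    by (simp add: indicator_def)
  ultimately show ?thesis by simp
qed

text \<open>
Apply the estimate for bounded windows with type \<open>\<sigma> + \<epsilon>\<close>, let \<open>\<epsilon>\<close> tend to \<open>0\<close>, and exhaust the line by
windows.
\<close>

theorem plancherel_polya:
  assumes f: "f holomorphic_on UNIV" and "exponential_type \<sigma> f" "0 < p" "0 \<le> \<sigma>"
    and M: "(\<integral>\<^sup>+x. ennreal (norm (f (of_real x)) powr p) \<partial>lborel) \<le> ennreal M" and "0 < M"
  shows "(\<integral>\<^sup>+x. ennreal (norm (f (Complex x y)) powr p) \<partial>lborel) \<le> ennreal (M * exp (p * \<sigma> * \<bar>y\<bar>))"
proof -
  have contf: "continuous_on UNIV f" using f holomorphic_on_imp_continuous_on by blast
  have meas: "(\<lambda>t. ennreal (norm (f (z + of_real t)) powr p)) \<in> borel_measurable borel" for z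
    using \<open>0 < p\<close>
    by (intro measurable_compose[OF borel_measurable_continuous_onI measurable_ennreal]
        continuous_on_powr' continuous_intros continuous_on_compose2[OF contf]) auto
  have window: "window_integral p N f z \<le> M * exp (p * \<sigma> * \<bar>Im z\<bar>)" if "0 < N" for N z
  proof -
    have real_bd: "window_integral p N f (of_real x) \<le> M" for x
    proof -
      have "ennreal (window_integral p N f (of_real x))
          \<le> (\<integral>\<^sup>+t. ennreal (norm (f (of_real x + of_real t)) powr p) \<partial>lborel)"
        unfolding window_integral_eq_nn_integral[OF f \<open>0 < p\<close>]
        by (intro nn_integral_mono) (auto simp: indicator_def)
      also have "\<dots> = (\<integral>\<^sup>+t. ennreal (norm (f (of_real t)) powr p) \<partial>lborel)"
        using nn_integral_real_affine[of "\<lambda>t. ennreal (norm (f (of_real t)) powr p)" 1 x] meas[of 0] by simp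
      finally have "ennreal (window_integral p N f (of_real x)) \<le> ennreal M" using M by simp
      then show ?thesis using \<open>0 < M\<close> by (simp add: ennreal_le_iff)
    qed
    have eps: "window_integral p N f z \<le> M * exp (p * (\<sigma> + \<epsilon>) * \<bar>Im z\<bar>)" if "\<epsilon> > 0" for \<epsilon>
    proof -
      have "\<exists>C. \<forall>z. norm (f z) \<le> C * exp ((\<sigma> + \<epsilon>) * norm z)"
        using \<open>exponential_type \<sigma> f\<close> that unfolding exponential_type_def by simp
      then obtain C where "\<And>z. norm (f z) \<le> C * exp ((\<sigma> + \<epsilon>) * norm z)" by auto
      then show ?thesis
        using that \<open>0 \<le> \<sigma>\<close> by (intro window_integral_plane[OF f \<open>0 < p\<close> \<open>0 < N\<close> _ _ real_bd \<open>0 < M\<close>]) auto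
    qed
    have "((\<lambda>\<epsilon>. M * exp (p * (\<sigma> + \<epsilon>) * \<bar>Im z\<bar>)) \<longlongrightarrow> M * exp (p * (\<sigma> + 0) * \<bar>Im z\<bar>)) (at_right 0)"
      by (intro tendsto_intros)
    moreover note eventually_mono[OF eventually_at_right_less eps]
    ultimately have "window_integral p N f z \<le> M * exp (p * (\<sigma> + 0) * \<bar>Im z\<bar>)"
      by (intro tendsto_lowerbound) auto
    then show ?thesis by simp
  qed
  define g where "g = (\<lambda>x. ennreal (norm (f (Complex x y)) powr p))"
  have g_eq: "g = (\<lambda>x. ennreal (norm (f (Complex 0 y + of_real x)) powr p))"
    unfolding g_def by (simp add: complex_eq_iff plus_complex.ctr complex_of_real_def)
  then have [measurable]: "g \<in> borel_measurable borel" using meas by simp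
  have "(\<integral>\<^sup>+x. g x \<partial>lborel) = (\<integral>\<^sup>+x. (SUP n. indicator {- real (Suc n)..real (Suc n)} x * g x) \<partial>lborel)"
  proof (rule nn_integral_cong)
    fix x
    obtain n :: nat where n: "\<bar>x\<bar> \<le> real n" using real_arch_simple by blast
    show "g x = (SUP n. indicator {- real (Suc n)..real (Suc n)} x * g x)"
    proof (rule antisym)
      show "g x \<le> (SUP n. indicator {- real (Suc n)..real (Suc n)} x * g x)"
        using n by (intro SUP_upper2[of n]) (auto simp: indicator_def)
      show "(SUP n. indicator {- real (Suc n)..real (Suc n)} x * g x) \<le> g x"
        by (intro SUP_least) (auto simp: indicator_def)
    qed
  qed
  also have "\<dots> = (SUP n. \<integral>\<^sup>+x. indicator {- real (Suc n)..real (Suc n)} x * g x \<partial>lborel)"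
  proof (rule nn_integral_monotone_convergence_SUP)
    show "incseq (\<lambda>n x. indicator {- real (Suc n)..real (Suc n)} x * g x)"
      by (auto simp: incseq_def le_fun_def indicator_def)
  qed measurable
  also have "\<dots> \<le> ennreal (M * exp (p * \<sigma> * \<bar>y\<bar>))"
  proof (rule SUP_least)
    fix n :: nat
    have "(\<integral>\<^sup>+x. indicator {- real (Suc n)..real (Suc n)} x * g x \<partial>lborel)
        = ennreal (window_integral p (real (Suc n)) f (Complex 0 y))"
      unfolding window_integral_eq_nn_integral[OF f \<open>0 < p\<close>] g_eq ..
    also have "\<dots> \<le> ennreal (M * exp (p * \<sigma> * \<bar>y\<bar>))"
      using window[of "real (Suc n)" "Complex 0 y"] by (intro ennreal_leI) simp
    finally show "(\<integral>\<^sup>+x. indicator {- real (Suc n)..real (Suc n)} x * g x \<partial>lborel) \<le> ennreal (M * exp (p * \<sigma> * \<bar>y\<bar>))" .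
  qed
  finally show ?thesis unfolding g_def .
qed

section \<open>Local bounds by area integrals\<close>

text \<open>
A submean inequality with a constant, which serves all \<open>p > 0\<close> alike. Let \<open>z0\<close> maximise
\<open>\<bar>F z\<bar> (\<rho> - dist w z) powr (2/p)\<close> over the disc and put \<open>d = \<rho> - dist w z0\<close>. Then \<open>\<bar>F\<bar>\<close> is at most
\<open>L \<bar>F z0\<bar>\<close> on the disc of radius \<open>d/2\<close> about \<open>z0\<close>. By Cauchy's estimate for \<open>F'\<close>, it is at least
\<open>\<bar>F z0\<bar> / 2\<close> on a disc of radius comparable to \<open>d\<close>, whose contribution to the integral is of order
\<open>d\<^sup>2 \<bar>F z0\<bar> ^ p \<ge> \<rho>\<^sup>2 \<bar>F w\<bar> ^ p\<close>.
\<close>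

lemma powr_area_bound:
  assumes "0 < p"
  obtains c where "0 < c"
    "\<And>F w \<rho>. F holomorphic_on UNIV \<Longrightarrow> 0 < \<rho> \<Longrightarrow>
      ennreal (c * \<rho>\<^sup>2 * norm (F w) powr p)
      \<le> (\<integral>\<^sup>+y. \<integral>\<^sup>+x. indicator (cball w \<rho>) (Complex x y) * ennreal (norm (F (Complex x y)) powr p) \<partial>lborel \<partial>lborel)"
proof -
  define L :: real where "L = 2 powr (2/p)"
  have L: "L \<ge> 1" unfolding L_def using \<open>0 < p\<close> by (intro ge_one_powr_ge_zero) auto
  define c where "c = (1/2) powr p / (64 * L\<^sup>2)"
  have "c > 0" using L by (simp add: c_def)
  moreover have "ennreal (c * \<rho>\<^sup>2 * norm (F w) powr p)
      \<le> (\<integral>\<^sup>+y. \<integral>\<^sup>+x. indicator (cball w \<rho>) (Complex x y) * ennreal (norm (F (Complex x y)) powr p) \<partial>lborel \<partial>lborel)"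
    if F: "F holomorphic_on UNIV" and "0 < \<rho>" for F and w :: complex and \<rho> :: real
  proof (cases "F w = 0")
    case True
    then show ?thesis by simp
  next
    case False
    have contF: "continuous_on A F" for A
      using F holomorphic_on_imp_continuous_on continuous_on_subset by blast
    define \<phi> where "\<phi> = (\<lambda>z. norm (F z) * (\<rho> - dist w z) powr (2/p))"
    have "continuous_on (cball w \<rho>) \<phi>"
      unfolding \<phi>_def using \<open>0 < p\<close>
      by (intro continuous_on_mult continuous_on_norm contF continuous_on_powr' continuous_intros) auto
    moreover have "cball w \<rho> \<noteq> {}" using \<open>0 < \<rho>\<close> by simp
    ultimately obtain z0 where z0: "z0 \<in> cball w \<rho>" "\<And>z. z \<in> cball w \<rho> \<Longrightarrow> \<phi> z \<le> \<phi> z0"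
      using continuous_attains_sup[OF compact_cball, of w \<rho> \<phi>] by blast
    define d where "d = \<rho> - dist w z0"
    have \<phi>w: "\<phi> w = norm (F w) * \<rho> powr (2/p)" by (simp add: \<phi>_def)
    have "\<phi> w \<le> \<phi> z0" using z0(2)[of w] \<open>0 < \<rho>\<close> by simp
    moreover have "\<phi> w > 0" unfolding \<phi>w using False \<open>0 < \<rho>\<close> by simp
    ultimately have "\<phi> z0 > 0" by linarith
    then have d: "d > 0" using z0(1) \<open>0 < p\<close> unfolding \<phi>_def d_def by (cases "dist w z0 = \<rho>") auto
    define m where "m = norm (F z0)"
    have \<phi>z0: "\<phi> z0 = m * d powr (2/p)" by (simp add: \<phi>_def m_def d_def)
    have "m > 0" using \<open>\<phi> z0 > 0\<close> unfolding \<phi>z0 by (simp add: zero_less_mult_iff)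
    have big: "norm (F z) \<le> L * m" if "dist z0 z \<le> d / 2" for z
    proof -
      have dz: "\<rho> - dist w z \<ge> d / 2" using dist_triangle[of w z z0] that by (simp add: d_def)
      then have "norm (F z) * (d/2) powr (2/p) \<le> \<phi> z"
        unfolding \<phi>_def using d \<open>0 < p\<close> by (intro mult_left_mono powr_mono2) auto
      also have "\<dots> \<le> m * d powr (2/p)" using z0(2)[of z] dz d unfolding \<phi>z0 by simp
      finally show ?thesis using d by (simp add: L_def powr_divide field_simps)
    qed
    \<comment> \<open>Cauchy's estimate on discs of radius \<open>d/4\<close>, which stay within distance \<open>d/2\<close> of \<open>z0\<close>.\<close>
    have half: "m / 2 \<le> norm (F z)" if z: "dist z0 z \<le> d / (8 * L)" for z
    proof -
      have dL: "d / (8 * L) \<le> d / 4" using L d by (simp add: field_simps)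
      have "norm (F z - F z0) \<le> (L * m / (d/4)) * norm (z - z0)"
      proof (rule field_differentiable_bound[of "cball z0 (d / (8 * L))" F "deriv F"])
        show "(F has_field_derivative deriv F v) (at v within cball z0 (d / (8 * L)))" for v
          using F holomorphic_derivI[of F UNIV v] by (simp add: has_field_derivative_at_within)
        fix v assume v: "v \<in> cball z0 (d / (8 * L))"
        have "norm ((deriv ^^ 1) F v) \<le> fact 1 * (L * m) / (d/4) ^ 1"
        proof (rule Cauchy_inequality)
          show "F holomorphic_on ball v (d/4)" using F holomorphic_on_subset by blast
          fix u assume "norm (v - u) = d/4"
          then have "dist z0 u \<le> d / 2"
            using dist_triangle[of z0 u v] v dL by (simp add: dist_norm)
          then show "norm (F u) \<le> L * m" by (rule big)
        qed (use d contF in auto)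
        then show "norm (deriv F v) \<le> L * m / (d/4)" by simp
      qed (use z d L in auto)
      also have "\<dots> \<le> (L * m / (d/4)) * (d / (8 * L))"
        using z L d \<open>m > 0\<close> by (intro mult_left_mono) (auto simp: dist_norm norm_minus_commute)
      also have "\<dots> = m / 2" using L d by (simp add: field_simps)
      finally show ?thesis using norm_triangle_ineq2[of "F z0" "F z"] unfolding m_def
        by (simp add: norm_minus_commute)
    qed
    define a where "a = d / (16 * L)"
    have "a > 0" using d L by (simp add: a_def)
    define I where "I = {Re z0 - a..Re z0 + a}"
    define I' where "I' = {Im z0 - a..Im z0 + a}"
    \<comment> \<open>A square of half-side \<open>a\<close> about \<open>z0\<close> lies in the disc of radius \<open>2 a = d / (8 L)\<close>.\<close>
    have pt: "indicator I' y * (indicator I x * ennreal ((m/2) powr p))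
        \<le> indicator (cball w \<rho>) (Complex x y) * ennreal (norm (F (Complex x y)) powr p)" for x y
    proof (cases "x \<in> I \<and> y \<in> I'")
      case True
      have "dist z0 (Complex x y) \<le> \<bar>Re z0 - x\<bar> + \<bar>Im z0 - y\<bar>"
        using cmod_le[of "z0 - Complex x y"] by (simp add: dist_norm)
      also have "\<dots> \<le> d / (8 * L)" using True by (auto simp: I_def I'_def a_def abs_le_iff)
      finally have dz: "dist z0 (Complex x y) \<le> d / (8 * L)" .
      moreover have "d / (8 * L) \<le> d" using L d by (simp add: field_simps)
      ultimately have "dist w (Complex x y) \<le> \<rho>"
        using dist_triangle[of w "Complex x y" z0] unfolding d_def by linarith
      moreover have "(m/2) powr p \<le> norm (F (Complex x y)) powr p"
        using half[OF dz] \<open>m > 0\<close> \<open>0 < p\<close> by (intro powr_mono2) auto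
      ultimately show ?thesis using True by (auto simp: ennreal_leI)
    qed (auto simp: indicator_def)
    have "c * \<rho>\<^sup>2 * norm (F w) powr p = (1/2) powr p / (64 * L\<^sup>2) * (\<phi> w) powr p"
      unfolding \<phi>w c_def using \<open>0 < p\<close> \<open>0 < \<rho>\<close> by (simp add: powr_mult powr_powr)
    also have "\<dots> \<le> (1/2) powr p / (64 * L\<^sup>2) * (\<phi> z0) powr p"
      using \<open>\<phi> w \<le> \<phi> z0\<close> \<open>\<phi> w > 0\<close> \<open>0 < p\<close> by (intro mult_left_mono powr_mono2) auto
    also have "\<dots> = (2 * a) * ((2 * a) * (m/2) powr p)"
      unfolding \<phi>z0 a_def using \<open>0 < p\<close> d \<open>m > 0\<close> L
      by (simp add: powr_mult powr_powr powr_divide power2_eq_square field_simps)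
    finally have "ennreal (c * \<rho>\<^sup>2 * norm (F w) powr p) \<le> ennreal (2 * a) * (ennreal (2 * a) * ennreal ((m/2) powr p))"
      using \<open>a > 0\<close> by (simp add: ennreal_leI flip: ennreal_mult)
    also have "\<dots> = (\<integral>\<^sup>+y. \<integral>\<^sup>+x. indicator I' y * (indicator I x * ennreal ((m/2) powr p)) \<partial>lborel \<partial>lborel)"
      using \<open>a > 0\<close> by (simp add: I_def I'_def nn_integral_cmult nn_integral_multc mult_ac)
    also have "\<dots> \<le> (\<integral>\<^sup>+y. \<integral>\<^sup>+x. indicator (cball w \<rho>) (Complex x y) * ennreal (norm (F (Complex x y)) powr p) \<partial>lborel \<partial>lborel)"
      by (intro nn_integral_mono pt)
    finally show ?thesis .
  qed
  ultimately show ?thesis using that by blast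
qed

definition weighted_area :: "real \<Rightarrow> real \<Rightarrow> (complex \<Rightarrow> complex) \<Rightarrow> real \<Rightarrow> real \<Rightarrow> ennreal" where
  "weighted_area p \<sigma> f R x =
    (\<integral>\<^sup>+y. indicator {-R..R} y *
      (\<integral>\<^sup>+u. indicator {x - R..x + R} u * ennreal (norm (f (Complex u y)) powr p * exp (- (p * \<sigma> * \<bar>y\<bar>))) \<partial>lborel) \<partial>lborel)"

lemma weight_measurable:
  assumes f: "f holomorphic_on UNIV" and "0 < p"
  shows "(\<lambda>(y, u). ennreal (norm (f (Complex u y)) powr p * exp (- (p * \<sigma> * \<bar>y\<bar>)))) \<in> borel_measurable (borel \<Otimes>\<^sub>M borel)"
proof -
  have contf: "continuous_on A f" for A
    using f holomorphic_on_imp_continuous_on continuous_on_subset by blast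
  have "continuous_on UNIV (\<lambda>q :: real \<times> real. Complex (snd q) (fst q))"
    unfolding complex_eq by (intro continuous_intros)
  then have "continuous_on UNIV (\<lambda>q :: real \<times> real. norm (f (Complex (snd q) (fst q))) powr p * exp (- (p * \<sigma> * \<bar>fst q\<bar>)))"
    using \<open>0 < p\<close> by (intro continuous_on_mult continuous_on_powr' continuous_on_norm
       continuous_on_compose2[OF contf[of UNIV]] continuous_intros) auto
  from borel_measurable_continuous_onI[OF this] show ?thesis
    by (simp add: borel_prod case_prod_unfold)
qed

text \<open>
Apply the area bound to \<open>f z exp (\<plusminus> \<i> \<sigma> z)\<close>, with the sign for which the modulus is
\<open>\<bar>f z\<bar> exp (- \<sigma> \<bar>Im z\<bar>)\<close> in the half plane of \<open>w\<close>. The condition on \<open>\<rho>\<close> says that the disc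
reaches at most \<open>1/\<sigma>\<close> into the other half plane, where the two weights differ by a bounded factor.
\<close>

lemma powr_weighted_area_bound:
  assumes "0 < p"
  obtains C where "0 < C"
    "\<And>f \<sigma> x R w \<rho>. f holomorphic_on UNIV \<Longrightarrow> 0 < \<sigma> \<Longrightarrow> 0 < \<rho> \<Longrightarrow> \<sigma> * \<rho> \<le> \<sigma> * \<bar>Im w\<bar> + 1 \<Longrightarrow>
      \<bar>Re w - x\<bar> + \<rho> \<le> R \<Longrightarrow> \<bar>Im w\<bar> + \<rho> \<le> R \<Longrightarrow>
      ennreal (\<rho>\<^sup>2 * (norm (f w) powr p * exp (- (p * \<sigma> * \<bar>Im w\<bar>)))) \<le> ennreal C * weighted_area p \<sigma> f R x"
proof -
  obtain c where c: "0 < c" and area: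
    "\<And>F w \<rho>. F holomorphic_on UNIV \<Longrightarrow> 0 < \<rho> \<Longrightarrow>
      ennreal (c * \<rho>\<^sup>2 * norm (F w) powr p)
      \<le> (\<integral>\<^sup>+y. \<integral>\<^sup>+x. indicator (cball w \<rho>) (Complex x y) * ennreal (norm (F (Complex x y)) powr p) \<partial>lborel \<partial>lborel)"
    using powr_area_bound[OF \<open>0 < p\<close>] by blast
  define C where "C = exp (2 * p) / c"
  have "C > 0" using c by (simp add: C_def)
  moreover have "ennreal (\<rho>\<^sup>2 * (norm (f w) powr p * exp (- (p * \<sigma> * \<bar>Im w\<bar>)))) \<le> ennreal C * weighted_area p \<sigma> f R x"
    if f: "f holomorphic_on UNIV" and \<sigma>: "0 < \<sigma>" and \<rho>: "0 < \<rho>" "\<sigma> * \<rho> \<le> \<sigma> * \<bar>Im w\<bar> + 1"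
      and R: "\<bar>Re w - x\<bar> + \<rho> \<le> R" "\<bar>Im w\<bar> + \<rho> \<le> R" for f \<sigma> x R w \<rho>
  proof -
    define \<epsilon> :: real where "\<epsilon> = (if 0 \<le> Im w then 1 else -1)"
    have \<epsilon>: "\<epsilon> * Im w = \<bar>Im w\<bar>" "\<bar>\<epsilon>\<bar> = 1" by (auto simp: \<epsilon>_def)
    define F where "F = (\<lambda>z. f z * exp (\<i> * of_real (\<epsilon> * \<sigma>) * z))"
    have F: "F holomorphic_on UNIV" unfolding F_def by (intro holomorphic_intros f)
    have nF: "norm (F z) powr p = norm (f z) powr p * exp (- (p * \<sigma> * (\<epsilon> * Im z)))" for z
      by (simp add: F_def norm_mult powr_mult exp_powr_real mult_ac)
    have pt: "indicator (cball w \<rho>) (Complex u y) * ennreal (norm (F (Complex u y)) powr p)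
       \<le> ennreal (exp (2 * p)) * (indicator {-R..R} y *
          (indicator {x - R..x + R} u * ennreal (norm (f (Complex u y)) powr p * exp (- (p * \<sigma> * \<bar>y\<bar>)))))" for u y
    proof (cases "Complex u y \<in> cball w \<rho>")
      case True
      have "\<bar>Re w - u\<bar> \<le> \<rho>" "\<bar>Im w - y\<bar> \<le> \<rho>"
        using True abs_Re_le_cmod[of "w - Complex u y"] abs_Im_le_cmod[of "w - Complex u y"]
        by (auto simp: dist_norm)
      moreover from this have "\<bar>Im w\<bar> - \<rho> \<le> \<epsilon> * y" using \<epsilon> by (auto simp: \<epsilon>_def split: if_splits)
      then have "\<sigma> * (\<bar>Im w\<bar> - \<rho>) \<le> \<sigma> * (\<epsilon> * y)" using \<sigma> by (intro mult_left_mono) auto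
      then have "- 1 \<le> \<sigma> * (\<epsilon> * y)" using \<rho>(2) by (simp add: algebra_simps)
      then have "\<sigma> * \<bar>y\<bar> - 2 \<le> \<sigma> * (\<epsilon> * y)" by (auto simp: \<epsilon>_def abs_if split: if_splits)
      then have "p * (\<sigma> * \<bar>y\<bar> - 2) \<le> p * (\<sigma> * (\<epsilon> * y))" using \<open>0 < p\<close> by (intro mult_left_mono) auto
      then have "exp (- (p * \<sigma> * (\<epsilon> * y))) \<le> exp (2 * p) * exp (- (p * \<sigma> * \<bar>y\<bar>))"
        by (simp add: algebra_simps flip: exp_add)
      then have "norm (F (Complex u y)) powr p \<le> norm (f (Complex u y)) powr p * (exp (2 * p) * exp (- (p * \<sigma> * \<bar>y\<bar>)))"
        unfolding nF by (intro mult_left_mono) auto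
      then have "ennreal (norm (F (Complex u y)) powr p) \<le> ennreal (exp (2 * p)) * ennreal (norm (f (Complex u y)) powr p * exp (- (p * \<sigma> * \<bar>y\<bar>)))"
        by (simp add: ennreal_leI mult_ac flip: ennreal_mult)
      moreover have "u \<in> {x - R..x + R}" "y \<in> {-R..R}" using calculation(1,2) R by auto
      ultimately show ?thesis using True by simp
    qed simp
    have contf: "continuous_on A f" for A
      using f holomorphic_on_imp_continuous_on continuous_on_subset by blast
    have "ennreal (c * \<rho>\<^sup>2 * norm (F w) powr p)
        \<le> (\<integral>\<^sup>+y. \<integral>\<^sup>+u. ennreal (exp (2 * p)) * (indicator {-R..R} y *
          (indicator {x - R..x + R} u * ennreal (norm (f (Complex u y)) powr p * exp (- (p * \<sigma> * \<bar>y\<bar>))))) \<partial>lborel \<partial>lborel)"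
      by (rule order.trans[OF area[OF F \<rho>(1)]]) (intro nn_integral_mono pt)
    also have "\<dots> = ennreal (exp (2 * p)) * weighted_area p \<sigma> f R x"
    proof -
      define G where "G = (\<lambda>y u. ennreal (norm (f (Complex u y)) powr p * exp (- (p * \<sigma> * \<bar>y\<bar>))))"
      have [measurable]: "case_prod G \<in> borel_measurable (borel \<Otimes>\<^sub>M borel)"
        unfolding G_def using weight_measurable[OF f \<open>0 < p\<close>] .
      have G: "ennreal (norm (f (Complex u y)) powr p * exp (- (p * \<sigma> * \<bar>y\<bar>))) = G y u" for y u
        by (simp add: G_def)
      show ?thesis
        unfolding weighted_area_def G by (simp add: nn_integral_cmult)
    qed
    finally have "ennreal (c * \<rho>\<^sup>2 * norm (F w) powr p) \<le> ennreal (exp (2 * p)) * weighted_area p \<sigma> f R x" .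
    then have "ennreal (1/c) * ennreal (c * \<rho>\<^sup>2 * norm (F w) powr p) \<le> ennreal (1/c) * (ennreal (exp (2 * p)) * weighted_area p \<sigma> f R x)"
      by (rule mult_left_mono) simp
    also have "ennreal (1/c) * ennreal (c * \<rho>\<^sup>2 * norm (F w) powr p) = ennreal (\<rho>\<^sup>2 * (norm (f w) powr p * exp (- (p * \<sigma> * \<bar>Im w\<bar>))))"
      unfolding nF \<epsilon>(1) using c by (simp add: mult.assoc flip: ennreal_mult)
    also have "ennreal (1/c) * (ennreal (exp (2 * p)) * weighted_area p \<sigma> f R x) = ennreal C * weighted_area p \<sigma> f R x"
      using c by (simp add: C_def mult.assoc[symmetric] flip: ennreal_mult)
    finally show ?thesis .
  qed
  ultimately show ?thesis using that by blast
qed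

section \<open>Cauchy's formula on the circle of radius s over sigma\<close>

text \<open>
The ratio of the right sides for \<open>n + 1\<close> and \<open>n\<close> is at least \<open>n + 1\<close>, because
\<open>(n + 1/2) ln (1 + 1/n) \<ge> 1\<close>.
\<close>

lemma fact_le_stirling:
  assumes "1 \<le> n"
  shows "fact n \<le> exp 1 * sqrt (real n) * (real n / exp 1) ^ n"
  using assms
proof (induction n rule: dec_induct)
  case base
  then show ?case by simp
next
  case (step n)
  have n: "real n > 0" using step by simp
  have "2 * (real (Suc n) - real n) / (real n + real (Suc n)) \<le> ln (real (Suc n)) - ln (real n)"
    using n by (intro ln_inverse_approx_ge) auto
  then have "1 / (real n + 1/2) \<le> ln (real (Suc n) / real n)"
    using n by (simp add: ln_div field_simps)
  then have "1 \<le> (real n + 1/2) * ln (real (Suc n) / real n)"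
    using n by (simp add: field_simps)
  then have "exp 1 \<le> exp ((real n + 1/2) * ln (real (Suc n) / real n))" by simp
  also have "\<dots> = (real (Suc n) / real n) ^ n * sqrt (real (Suc n) / real n)"
    using n by (simp add: exp_add distrib_right exp_of_nat_mult ln_sqrt[symmetric] exp_ln real_sqrt_gt_0_iff)
  finally have e: "exp 1 * (real n ^ n * sqrt (real n)) \<le> real (Suc n) ^ n * sqrt (real (Suc n))"
    using n by (simp add: power_divide real_sqrt_divide field_simps)
  have "fact (Suc n) = real (Suc n) * fact n" by simp
  also have "\<dots> \<le> real (Suc n) * (exp 1 * sqrt (real n) * (real n / exp 1) ^ n)"
    by (intro mult_left_mono step.IH) auto
  also have "\<dots> = real (Suc n) * (exp 1 * (real n ^ n * sqrt (real n))) / exp 1 ^ n"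
    by (simp add: power_divide)
  also have "\<dots> \<le> real (Suc n) * (real (Suc n) ^ n * sqrt (real (Suc n))) / exp 1 ^ n"
    using e by (intro divide_right_mono mult_left_mono) auto
  also have "\<dots> = exp 1 * sqrt (real (Suc n)) * (real (Suc n) / exp 1) ^ Suc n"
    by (simp add: power_divide)
  finally show ?case .
qed

text \<open>
Jordan's inequality: a concave function lies above its chord.
\<close>

lemma jordan_sin_ge:
  assumes "0 \<le> x" "x \<le> pi / 2"
  shows "2 / pi * x \<le> sin x"
proof -
  have "concave_on {0..pi/2} sin"
    by (rule f''_le0_imp_concave[where f' = cos and f'' = "\<lambda>x. - sin x"])
       (auto intro!: derivative_eq_intros sin_ge_zero)
  from concave_onD_Icc'[OF this, of x] assms show ?thesis by simp
qed

lemma cos_sq_ge_near_quarter: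
  assumes "0 \<le> t" "t \<le> 1/2"
  shows "16 * (t - 1/4)\<^sup>2 \<le> (cos (2 * pi * t))\<^sup>2"
proof -
  define u where "u = \<bar>2 * pi * t - pi / 2\<bar>"
  have u: "0 \<le> u" "u \<le> pi / 2" unfolding u_def using assms
    by (auto simp: abs_le_iff field_simps intro: mult_left_mono)
  have "4 * \<bar>t - 1/4\<bar> = 2 / pi * u"
    unfolding u_def by (simp add: abs_if field_simps split: if_splits)
  also have "\<dots> \<le> sin u" using u by (rule jordan_sin_ge)
  finally have "(4 * \<bar>t - 1/4\<bar>)\<^sup>2 \<le> (sin u)\<^sup>2" by (intro power_mono) auto
  moreover have "(sin u)\<^sup>2 = (sin (2 * pi * t - pi / 2))\<^sup>2" by (cases "2 * pi * t - pi / 2 < 0") (auto simp: u_def abs_if sin_diff)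
  moreover have "sin (2 * pi * t - pi / 2) = - cos (2 * pi * t)" by (simp add: sin_diff)
  ultimately show ?thesis by (simp add: power_mult_distrib)
qed

lemma cos_sq_ge_near_three_quarters:
  assumes "1/2 \<le> t" "t \<le> 1"
  shows "16 * (t - 3/4)\<^sup>2 \<le> (cos (2 * pi * t))\<^sup>2"
proof -
  have "16 * ((t - 1/2) - 1/4)\<^sup>2 \<le> (cos (2 * pi * (t - 1/2)))\<^sup>2"
    using assms by (intro cos_sq_ge_near_quarter) auto
  moreover have "cos (2 * pi * (t - 1/2)) = - cos (2 * pi * t)" by (simp add: algebra_simps cos_diff)
  moreover have "(t - 1/2) - 1/4 = t - 3/4" by simp
  ultimately show ?thesis by simp
qed

lemma integral_lorentzian_le:
  fixes k c :: real
  assumes "0 < k"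
  shows "integral {0..1} (\<lambda>t. 1 / (1 + (k * (t - c))\<^sup>2)) \<le> pi / k"
proof -
  have "((\<lambda>t. 1 / (1 + (k * (t - c))\<^sup>2)) has_integral
      arctan (k * (1 - c)) / k - arctan (k * (0 - c)) / k) {0..1}"
  proof (rule fundamental_theorem_of_calculus)
    show "((\<lambda>t. arctan (k * (t - c)) / k) has_vector_derivative 1 / (1 + (k * (t - c))\<^sup>2)) (at t within {0..1})" for t
      unfolding has_real_derivative_iff_has_vector_derivative[symmetric]
      using assms by (auto intro!: derivative_eq_intros simp: inverse_eq_divide)
  qed simp
  then have "integral {0..1} (\<lambda>t. 1 / (1 + (k * (t - c))\<^sup>2)) = (arctan (k * (1 - c)) - arctan (k * (0 - c))) / k"
    by (simp add: integral_unique diff_divide_distrib)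
  also have "\<dots> \<le> pi / k"
    using arctan_bounded[of "k * (1 - c)"] arctan_bounded[of "k * (0 - c)"] assms by (intro divide_right_mono) auto
  finally show ?thesis .
qed

text \<open>
The integrand is concentrated at \<open>t = 1/4\<close> and \<open>t = 3/4\<close> with width of order \<open>1 / sqrt a\<close>. Since
\<open>1 - \<bar>sin\<bar> \<ge> cos\<^sup>2 / 2\<close> and \<open>exp (- x) \<le> 1 / (1 + x)\<close>, it is dominated by two Lorentzian functions,
whose integrals are elementary.
\<close>

lemma integral_gaussian_on_circle_le:
  fixes a :: real
  assumes "0 < a"
  shows "integral {0..1} (\<lambda>t. exp (- (a / 2 * (1 - \<bar>sin (2 * pi * t)\<bar>)))) \<le> pi / sqrt a"
proof -
  define k where "k = 2 * sqrt a"
  have k: "k > 0" "k\<^sup>2 = 4 * a" using assms by (auto simp: k_def power_mult_distrib)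
  have cont: "continuous_on {0..1} (\<lambda>t. 1 / (1 + (k * (t - c))\<^sup>2))" for c
    by (intro continuous_intros) (auto simp: add_nonneg_eq_0_iff)
  have pt: "exp (- (a / 2 * (1 - \<bar>sin (2 * pi * t)\<bar>))) \<le> 1 / (1 + (k * (t - 1/4))\<^sup>2) + 1 / (1 + (k * (t - 3/4))\<^sup>2)"
    if t: "t \<in> {0..1}" for t
  proof -
    define S where "S = \<bar>sin (2 * pi * t)\<bar>"
    have S: "0 \<le> S" "S \<le> 1" by (simp_all add: S_def)
    have "(cos (2 * pi * t))\<^sup>2 = (1 - S) * (1 + S)"
      using sin_cos_squared_add[of "2 * pi * t"] by (simp add: S_def algebra_simps flip: power2_eq_square)
    also have "\<dots> \<le> (1 - S) * 2" using S by (intro mult_left_mono) auto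
    finally have cos_le: "(cos (2 * pi * t))\<^sup>2 \<le> 2 * (1 - S)" by simp
    have main: "exp (- (a / 2 * (1 - S))) \<le> 1 / (1 + (k * (t - c))\<^sup>2)" if "16 * (t - c)\<^sup>2 \<le> (cos (2 * pi * t))\<^sup>2" for c
    proof -
      have "a * (8 * (t - c)\<^sup>2) \<le> a * (1 - S)"
        using that cos_le assms by (intro mult_left_mono) auto
      then have "(k * (t - c))\<^sup>2 \<le> a / 2 * (1 - S)" by (simp add: power_mult_distrib k(2))
      then have "1 + (k * (t - c))\<^sup>2 \<le> exp (a / 2 * (1 - S))"
        using exp_ge_add_one_self[of "a / 2 * (1 - S)"] by linarith
      then show ?thesis
        by (simp add: exp_minus inverse_eq_divide divide_left_mono add_pos_nonneg)
    qed
    have nonneg: "0 \<le> 1 / (1 + (k * (t - c))\<^sup>2)" for c by simp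
    show ?thesis
    proof (cases "t \<le> 1/2")
      case True
      then have "exp (- (a / 2 * (1 - S))) \<le> 1 / (1 + (k * (t - 1/4))\<^sup>2)"
        using t by (intro main cos_sq_ge_near_quarter) auto
      then show ?thesis using nonneg[of "3/4"] unfolding S_def by linarith
    next
      case False
      then have "exp (- (a / 2 * (1 - S))) \<le> 1 / (1 + (k * (t - 3/4))\<^sup>2)"
        using t by (intro main cos_sq_ge_near_three_quarters) auto
      then show ?thesis using nonneg[of "1/4"] unfolding S_def by linarith
    qed
  qed
  have "integral {0..1} (\<lambda>t. exp (- (a / 2 * (1 - \<bar>sin (2 * pi * t)\<bar>))))
      \<le> integral {0..1} (\<lambda>t. 1 / (1 + (k * (t - 1/4))\<^sup>2) + 1 / (1 + (k * (t - 3/4))\<^sup>2))"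
    by (intro integral_le integrable_continuous_real continuous_on_add cont pt) (intro continuous_intros)
  also have "\<dots> = integral {0..1} (\<lambda>t. 1 / (1 + (k * (t - 1/4))\<^sup>2)) + integral {0..1} (\<lambda>t. 1 / (1 + (k * (t - 3/4))\<^sup>2))"
    by (intro integral_add integrable_continuous_real cont)
  also have "\<dots> \<le> pi / k + pi / k" by (intro add_mono integral_lorentzian_le k)
  also have "\<dots> = pi / sqrt a" by (simp add: k_def)
  finally show ?thesis .
qed

text \<open>
The admitted growth on the circle of radius \<open>r = s / \<sigma>\<close> is \<open>exp s\<close> times a factor whose mean is of order
\<open>1 / sqrt s\<close>. Stirling's bound for \<open>s!\<close> absorbs exactly this.
\<close>

lemma higher_deriv_bound_circle:
  fixes f :: "complex \<Rightarrow> complex"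
  assumes f: "f holomorphic_on UNIV" and "1 \<le> s" "0 < \<sigma>"
    and bd: "\<And>t. 0 \<le> t \<Longrightarrow> t \<le> 1 \<Longrightarrow>
      norm (f (circlepath z (real s / \<sigma>) t)) \<le> D * exp (real s / 2 * (1 + \<bar>sin (2 * pi * t)\<bar>))"
  shows "norm ((deriv ^^ s) f z) \<le> exp 1 * pi * \<sigma> ^ s * D"
proof -
  define r where "r = real s / \<sigma>"
  have r: "r > 0" "real s > 0" using assms by (auto simp: r_def)
  define h where "h = (\<lambda>t. exp (- (real s / 2 * (1 - \<bar>sin (2 * pi * t)\<bar>))))"
  have D: "0 \<le> D"
  proof -
    have "0 \<le> D * exp (real s / 2 * (1 + \<bar>sin (2 * pi * 0)\<bar>))"
      by (rule order.trans[OF norm_ge_zero bd]) auto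
    then show ?thesis by (simp add: zero_le_mult_iff)
  qed
  define I where "I = of_real (2 * pi) * \<i> / fact s * (deriv ^^ s) f z"
  have "((\<lambda>u. f u / (u - z) ^ Suc s) has_contour_integral I) (circlepath z r)"
    unfolding I_def
  proof (rule Cauchy_has_contour_integral_higher_derivative_circlepath)
    show "continuous_on (cball z r) f"
      using holomorphic_on_imp_continuous_on[OF holomorphic_on_subset[OF f subset_UNIV]] .
    show "f holomorphic_on ball z r" by (rule holomorphic_on_subset[OF f subset_UNIV])
  qed (use r in simp)
  then have hi: "((\<lambda>t. f (circlepath z r t) / (circlepath z r t - z) ^ Suc s *
      vector_derivative (circlepath z r) (at t within {0..1})) has_integral I) {0..1}"
    unfolding has_contour_integral_def .
  have inth: "h integrable_on {0..1}"
    unfolding h_def by (intro integrable_continuous_real continuous_intros)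
  have "norm I \<le> integral {0..1} (\<lambda>t. 2 * pi * D * exp (real s) / r ^ s * h t)"
    unfolding integral_unique[OF hi, symmetric]
  proof (rule integral_norm_bound_integral)
    show "(\<lambda>t. f (circlepath z r t) / (circlepath z r t - z) ^ Suc s *
      vector_derivative (circlepath z r) (at t within {0..1})) integrable_on {0..1}"
      by (rule has_integral_integrable[OF hi])
    show "(\<lambda>t. 2 * pi * D * exp (real s) / r ^ s * h t) integrable_on {0..1}"
      by (intro integrable_on_mult_right inth)
    fix t :: real assume t: "t \<in> {0..1}"
    have e1: "norm (exp (2 * of_real pi * \<i> * of_real t)) = 1"
      by simp
    have "norm (circlepath z r t - z) = r"
      unfolding circlepath using r e1 by (simp add: norm_mult)
    moreover have "norm (vector_derivative (circlepath z r) (at t within {0..1})) = 2 * pi * r"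
      using t r e1 by (simp add: vector_derivative_circlepath01 norm_mult)
    ultimately have "norm (f (circlepath z r t) / (circlepath z r t - z) ^ Suc s *
      vector_derivative (circlepath z r) (at t within {0..1})) = norm (f (circlepath z r t)) * (2 * pi / r ^ s)"
      using r by (simp add: norm_mult norm_divide norm_power)
    also have "\<dots> \<le> D * exp (real s / 2 * (1 + \<bar>sin (2 * pi * t)\<bar>)) * (2 * pi / r ^ s)"
      using bd[of t] t r by (intro mult_right_mono) (auto simp: r_def)
    also have "exp (real s / 2 * (1 + \<bar>sin (2 * pi * t)\<bar>)) = exp (real s) * h t"
      by (simp add: h_def algebra_simps flip: exp_add)
    finally show "norm (f (circlepath z r t) / (circlepath z r t - z) ^ Suc s *
      vector_derivative (circlepath z r) (at t within {0..1})) \<le> 2 * pi * D * exp (real s) / r ^ s * h t"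
      by (simp add: mult_ac)
  qed
  also have "\<dots> = 2 * pi * D * exp (real s) / r ^ s * integral {0..1} h" by simp
  also have "\<dots> \<le> 2 * pi * D * exp (real s) / r ^ s * (pi / sqrt (real s))"
    using integral_gaussian_on_circle_le[OF r(2)] D r unfolding h_def by (intro mult_left_mono) auto
  finally have "norm I \<le> 2 * pi * D * exp (real s) / r ^ s * (pi / sqrt (real s))" .
  moreover have "norm I = 2 * pi / fact s * norm ((deriv ^^ s) f z)"
    by (simp add: I_def norm_mult norm_divide)
  moreover have "2 * pi * D * exp (real s) / r ^ s * (pi / sqrt (real s))
      = 2 * pi / fact s * (fact s * (D * exp (real s) / r ^ s * (pi / sqrt (real s))))"
    by simp
  ultimately have "2 * pi / fact s * norm ((deriv ^^ s) f z)
      \<le> 2 * pi / fact s * (fact s * (D * exp (real s) / r ^ s * (pi / sqrt (real s))))"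
    by simp
  then have "norm ((deriv ^^ s) f z) \<le> fact s * (D * exp (real s) / r ^ s * (pi / sqrt (real s)))"
    by (rule mult_left_le_imp_le) simp
  also have "\<dots> \<le> (exp 1 * sqrt (real s) * (real s / exp 1) ^ s) * (D * exp (real s) / r ^ s * (pi / sqrt (real s)))"
    using D r by (intro mult_right_mono fact_le_stirling \<open>1 \<le> s\<close>) auto
  also have "\<dots> = exp 1 * pi * \<sigma> ^ s * D"
  proof -
    have "exp (real s) = exp 1 ^ s" using exp_of_nat_mult[of s "1::real"] by simp
    then show ?thesis using r \<open>0 < \<sigma>\<close> by (simp add: r_def power_divide field_simps)
  qed
  finally show ?thesis .
qed

section \<open>The upper bound\<close>

text \<open>
On the circle of radius \<open>r = s / \<sigma>\<close> about \<open>x\<close>, the local bound is used with radius \<open>r/2\<close> at points of height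
at least \<open>r/2\<close>, where it costs a factor \<open>4\<close>, and with radius \<open>1/\<sigma>\<close> elsewhere. There it costs \<open>s\<^sup>2\<close>, which
is harmless: at low points \<open>exp (s \<bar>sin \<theta>\<bar>)\<close> is exponentially smaller than the bound
\<open>exp (s (1 + \<bar>sin \<theta>\<bar>) / 2)\<close> that Cauchy's formula tolerates.
\<close>

lemma higher_deriv_powr_le_weighted_area:
  assumes "0 < p"
  obtains C where "0 < C"
    "\<And>f \<sigma> s x. f holomorphic_on UNIV \<Longrightarrow> 0 < \<sigma> \<Longrightarrow> 1 \<le> s \<Longrightarrow>
      ennreal (norm ((deriv ^^ s) f (of_real x)) powr p)
      \<le> ennreal (C * \<sigma> powr (real s * p) / (real s / \<sigma>)\<^sup>2) * weighted_area p \<sigma> f (2 * (real s / \<sigma>)) x"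
proof -
  obtain C0 where C0: "0 < C0" and area: 
    "\<And>f \<sigma> x R w \<rho>. f holomorphic_on UNIV \<Longrightarrow> 0 < \<sigma> \<Longrightarrow> 0 < \<rho> \<Longrightarrow> \<sigma> * \<rho> \<le> \<sigma> * \<bar>Im w\<bar> + 1 \<Longrightarrow>
      \<bar>Re w - x\<bar> + \<rho> \<le> R \<Longrightarrow> \<bar>Im w\<bar> + \<rho> \<le> R \<Longrightarrow>
      ennreal (\<rho>\<^sup>2 * (norm (f w) powr p * exp (- (p * \<sigma> * \<bar>Im w\<bar>)))) \<le> ennreal C0 * weighted_area p \<sigma> f R x"
    using powr_weighted_area_bound[OF \<open>0 < p\<close>] by blast
  \<comment> \<open>The summands of \<open>K\<close> account for the high and for the low points of the circle: \<open>s\<^sup>2 \<le> (8/p)\<^sup>2 exp (p s / 4)\<close>.\<close>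
  define K where "K = C0 * (4 + (8/p)\<^sup>2)"
  define C where "C = (exp 1 * pi) powr p * K"
  have "K > 0" using C0 by (simp add: K_def add_pos_nonneg)
  then have "C > 0" by (simp add: C_def)
  moreover have "ennreal (norm ((deriv ^^ s) f (of_real x)) powr p)
      \<le> ennreal (C * \<sigma> powr (real s * p) / (real s / \<sigma>)\<^sup>2) * weighted_area p \<sigma> f (2 * (real s / \<sigma>)) x"
    if f: "f holomorphic_on UNIV" and \<sigma>: "0 < \<sigma>" and s: "1 \<le> s" for f \<sigma> s x
  proof -
    define r where "r = real s / \<sigma>"
    have r: "r > 0" "\<sigma> * r = real s" using \<sigma> s by (auto simp: r_def)
    define J where "J = weighted_area p \<sigma> f (2 * r) x"
    show ?thesis
    proof (cases "J = \<infinity>")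
      case True
      have "ennreal a * J = \<infinity>" if "0 < a" for a
        using that True by (simp add: ennreal_mult_eq_top_iff)
      moreover have "C * \<sigma> powr (real s * p) / (real s / \<sigma>)\<^sup>2 > 0" using \<open>C > 0\<close> \<sigma> s by auto
      ultimately have "ennreal (C * \<sigma> powr (real s * p) / (real s / \<sigma>)\<^sup>2) * J = \<infinity>" by blast
      then show ?thesis unfolding J_def r_def by simp
    next
      case False
      define j where "j = enn2real J"
      have j: "J = ennreal j" "0 \<le> j" using False by (auto simp: j_def less_top)
      define D where "D = (K * j / r\<^sup>2) powr (1/p)"
      have "norm (f (circlepath (of_real x) r t)) \<le> D * exp (real s / 2 * (1 + \<bar>sin (2 * pi * t)\<bar>))" for t
      proof -
        define w where "w = circlepath (of_real x) r t"
        define S where "S = \<bar>sin (2 * pi * t)\<bar>"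
        have S: "0 \<le> S" "S \<le> 1" by (simp_all add: S_def)
        have w_eq: "w = of_real x + of_real r * cis (2 * pi * t)"
          by (simp add: w_def circlepath cis_conv_exp mult_ac)
        have Imw: "\<bar>Im w\<bar> = r * S" using r by (simp add: w_eq S_def abs_mult)
        have Rew: "\<bar>Re w - x\<bar> \<le> r" using r by (simp add: w_eq abs_mult mult_left_le)
        have rS: "r * S \<le> r" using S r by (simp add: mult_left_le)
        have sS: "\<sigma> * \<bar>Im w\<bar> = real s * S" unfolding Imw using r by simp
        then have eS: "p * \<sigma> * \<bar>Im w\<bar> = p * (real s * S)" by (simp only: mult.assoc)
        have r1: "1 / \<sigma> \<le> r" using r \<sigma> s by (simp add: r_def divide_right_mono)
        have inR: "\<bar>Re w - x\<bar> + r/2 \<le> 2 * r" "\<bar>Im w\<bar> + r/2 \<le> 2 * r"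
          "\<bar>Re w - x\<bar> + 1/\<sigma> \<le> 2 * r" "\<bar>Im w\<bar> + 1/\<sigma> \<le> 2 * r"
          using Rew rS r1 r unfolding Imw by linarith+
        have fw: "norm (f w) powr p \<le> K * j / r\<^sup>2 * exp (p * (real s / 2 * (1 + S)))"
        proof (cases "1/2 \<le> S")
          case True
          have "ennreal ((r/2)\<^sup>2 * (norm (f w) powr p * exp (- (p * \<sigma> * \<bar>Im w\<bar>)))) \<le> ennreal C0 * J"
            unfolding J_def
          proof (rule area[OF f \<sigma>])
            show "\<sigma> * (r/2) \<le> \<sigma> * \<bar>Im w\<bar> + 1" unfolding sS using r True mult_left_mono[OF True, of "real s"] by simp
          qed (use r inR in simp_all)
          then have "(r/2)\<^sup>2 * (norm (f w) powr p * exp (- (p * \<sigma> * \<bar>Im w\<bar>))) \<le> C0 * j"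
            using j C0 by (simp add: ennreal_le_iff flip: ennreal_mult)
          then have "norm (f w) powr p \<le> (4 * C0) * j / r\<^sup>2 * exp (p * (real s * S))"
            using r unfolding eS by (simp add: exp_minus power_divide field_simps)
          also have "\<dots> \<le> K * j / r\<^sup>2 * exp (p * (real s / 2 * (1 + S)))"
          proof (intro mult_mono divide_right_mono)
            have "real s * (2 * S) \<le> real s * (1 + S)" using S by (intro mult_left_mono) auto
            then show "exp (p * (real s * S)) \<le> exp (p * (real s / 2 * (1 + S)))" using \<open>0 < p\<close> by simp
          qed (use j C0 in \<open>auto simp: K_def algebra_simps\<close>)
          finally show ?thesis .
        next
          case False
          have "ennreal ((1/\<sigma>)\<^sup>2 * (norm (f w) powr p * exp (- (p * \<sigma> * \<bar>Im w\<bar>)))) \<le> ennreal C0 * J"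
            unfolding J_def by (rule area[OF f \<sigma>]) (use \<sigma> inR in simp_all)
          then have "(1/\<sigma>)\<^sup>2 * (norm (f w) powr p * exp (- (p * \<sigma> * \<bar>Im w\<bar>))) \<le> C0 * j"
            using j C0 by (simp add: ennreal_le_iff flip: ennreal_mult)
          then have "norm (f w) powr p \<le> C0 * j * \<sigma>\<^sup>2 * exp (p * (real s * S))"
            using \<sigma> unfolding eS by (simp add: exp_minus power_divide field_simps)
          also have "\<dots> = C0 * j / r\<^sup>2 * ((real s)\<^sup>2 * exp (p * (real s * S)))"
            using r \<sigma> s by (simp add: r_def power_divide)
          also have "\<dots> \<le> C0 * j / r\<^sup>2 * ((8/p)\<^sup>2 * exp (p * (real s / 2 * (1 + S))))"
          proof (intro mult_left_mono)
            have "p * real s / 8 \<le> exp (p * real s / 8)"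
              using exp_ge_add_one_self[of "p * real s / 8"] by linarith
            then have "real s \<le> 8/p * exp (p * real s / 8)" using \<open>0 < p\<close> by (simp add: field_simps)
            then have "(real s)\<^sup>2 \<le> (8/p * exp (p * real s / 8))\<^sup>2" by (intro power_mono) auto
            also have "\<dots> = (8/p)\<^sup>2 * exp (p * real s / 4)"
              by (simp add: power2_eq_square flip: exp_add)
            finally have "(real s)\<^sup>2 * exp (p * (real s * S)) \<le> (8/p)\<^sup>2 * exp (p * real s / 4) * exp (p * (real s * S))"
              by (intro mult_right_mono) auto
            also have "\<dots> = (8/p)\<^sup>2 * exp (p * (real s * (1/4 + S)))" by (simp add: algebra_simps flip: exp_add)
            also have "\<dots> \<le> (8/p)\<^sup>2 * exp (p * (real s * ((1 + S) / 2)))"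
              using False \<open>0 < p\<close> by (intro mult_left_mono) (auto intro!: mult_left_mono)
            finally show "(real s)\<^sup>2 * exp (p * (real s * S)) \<le> (8/p)\<^sup>2 * exp (p * (real s / 2 * (1 + S)))" by simp
          qed (use C0 j in auto)
          also have "\<dots> = (C0 * (8/p)\<^sup>2) * j / r\<^sup>2 * exp (p * (real s / 2 * (1 + S)))" by simp
          also have "\<dots> \<le> K * j / r\<^sup>2 * exp (p * (real s / 2 * (1 + S)))"
            using j C0 by (intro mult_right_mono divide_right_mono) (auto simp: K_def algebra_simps)
          finally show ?thesis .
        qed
        have "norm (f w) = (norm (f w) powr p) powr (1/p)" using \<open>0 < p\<close> by (simp add: powr_powr)
        also have "\<dots> \<le> (K * j / r\<^sup>2 * exp (p * (real s / 2 * (1 + S)))) powr (1/p)"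
          using fw \<open>0 < p\<close> by (intro powr_mono2) auto
        also have "\<dots> = D * exp (p * (real s / 2 * (1 + S))) powr (1/p)"
          unfolding D_def by (rule powr_mult)
        also have "exp (p * (real s / 2 * (1 + S))) powr (1/p) = exp (real s / 2 * (1 + S))"
          using \<open>0 < p\<close> by (simp add: exp_powr_real)
        finally show ?thesis unfolding w_def S_def .
      qed
      then have "norm ((deriv ^^ s) f (of_real x)) \<le> exp 1 * pi * \<sigma> ^ s * D"
        unfolding r_def by (intro higher_deriv_bound_circle f s \<sigma>)
      then have "norm ((deriv ^^ s) f (of_real x)) powr p \<le> (exp 1 * pi * \<sigma> ^ s * D) powr p"
        using \<open>0 < p\<close> by (intro powr_mono2) auto
      also have "\<dots> = (exp 1 * pi) powr p * \<sigma> powr (real s * p) * (K * j / r\<^sup>2)"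
        using \<sigma> \<open>0 < p\<close> \<open>K > 0\<close> j by (simp add: D_def powr_mult powr_powr powr_realpow[symmetric])
      also have "\<dots> = C * \<sigma> powr (real s * p) / r\<^sup>2 * j" by (simp add: C_def)
      finally have "norm ((deriv ^^ s) f (of_real x)) powr p \<le> C * \<sigma> powr (real s * p) / r\<^sup>2 * j" .
      then show ?thesis
        unfolding r_def[symmetric] J_def[symmetric] j(1) using j(2) \<open>C > 0\<close>
        by (simp add: ennreal_leI flip: ennreal_mult)
    qed
  qed
  ultimately show ?thesis using that by blast
qed

lemma weighted_line_integral_le:
  assumes f: "f holomorphic_on UNIV" and "exponential_type \<sigma> f" "0 < p" "0 \<le> \<sigma>"
    and M: "(\<integral>\<^sup>+x. ennreal (norm (f (of_real x)) powr p) \<partial>lborel) \<le> ennreal M" and "0 < M"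
  shows "(\<integral>\<^sup>+u. ennreal (norm (f (Complex u y)) powr p * exp (- (p * \<sigma> * \<bar>y\<bar>))) \<partial>lborel) \<le> ennreal M"
proof -
  let ?e = "exp (- (p * \<sigma> * \<bar>y\<bar>))"
  have contf: "continuous_on A f" for A
    using f holomorphic_on_imp_continuous_on continuous_on_subset by blast
  have "continuous_on UNIV (\<lambda>u. norm (f (Complex u y)) powr p)"
    using \<open>0 < p\<close> by (intro continuous_on_powr' continuous_on_norm continuous_on_compose2[OF contf[of UNIV]] continuous_intros) auto
  then have [measurable]: "(\<lambda>u. norm (f (Complex u y)) powr p) \<in> borel_measurable borel"
    by (rule borel_measurable_continuous_onI)
  have "(\<integral>\<^sup>+u. ennreal (norm (f (Complex u y)) powr p * ?e) \<partial>lborel)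
      = (\<integral>\<^sup>+u. ennreal (norm (f (Complex u y)) powr p) \<partial>lborel) * ennreal ?e"
    by (simp add: ennreal_mult nn_integral_multc)
  also have "\<dots> \<le> ennreal (M * exp (p * \<sigma> * \<bar>y\<bar>)) * ennreal ?e"
    by (intro mult_right_mono plancherel_polya assms) auto
  also have "\<dots> = ennreal M" using \<open>0 < M\<close> by (simp add: exp_minus flip: ennreal_mult)
  finally show ?thesis .
qed

lemma weighted_area_le:
  assumes f: "f holomorphic_on UNIV" and "exponential_type \<sigma> f" "0 < p" "0 \<le> \<sigma>"
    and M: "(\<integral>\<^sup>+x. ennreal (norm (f (of_real x)) powr p) \<partial>lborel) \<le> ennreal M" and "0 < M" and "0 < R"
  shows "weighted_area p \<sigma> f R x \<le> ennreal (2 * R * M)"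
proof -
  have "weighted_area p \<sigma> f R x \<le> (\<integral>\<^sup>+y. indicator {-R..R} y * ennreal M \<partial>lborel)"
    unfolding weighted_area_def
  proof (intro nn_integral_mono mult_left_mono)
    fix y
    have "(\<integral>\<^sup>+u. indicator {x - R..x + R} u * ennreal (norm (f (Complex u y)) powr p * exp (- (p * \<sigma> * \<bar>y\<bar>))) \<partial>lborel)
        \<le> (\<integral>\<^sup>+u. ennreal (norm (f (Complex u y)) powr p * exp (- (p * \<sigma> * \<bar>y\<bar>))) \<partial>lborel)"
      by (intro nn_integral_mono) (auto simp: indicator_def)
    also have "\<dots> \<le> ennreal M" by (rule weighted_line_integral_le[OF assms(1-6)])
    finally show "(\<integral>\<^sup>+u. indicator {x - R..x + R} u * ennreal (norm (f (Complex u y)) powr p * exp (- (p * \<sigma> * \<bar>y\<bar>))) \<partial>lborel) \<le> ennreal M" .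
  qed auto
  also have "\<dots> = ennreal (2 * R * M)"
    using \<open>0 < R\<close> \<open>0 < M\<close> by (simp add: nn_integral_multc flip: ennreal_mult)
  finally show ?thesis .
qed

text \<open>
By Tonelli's theorem each point \<open>u + \<i> y\<close> of the strip is counted for \<open>x\<close> in an interval of length \<open>2 R\<close>, and the
strip has height \<open>2 R\<close>.
\<close>

lemma integral_weighted_area_le:
  assumes f: "f holomorphic_on UNIV" and "exponential_type \<sigma> f" "0 < p" "0 \<le> \<sigma>"
    and M: "(\<integral>\<^sup>+x. ennreal (norm (f (of_real x)) powr p) \<partial>lborel) \<le> ennreal M" and "0 < M" and "0 < R"
  shows "(\<integral>\<^sup>+x. weighted_area p \<sigma> f R x \<partial>lborel) \<le> ennreal (4 * R\<^sup>2 * M)"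
    and "weighted_area p \<sigma> f R \<in> borel_measurable borel"
proof -
  define G where "G = (\<lambda>y u. ennreal (norm (f (Complex u y)) powr p * exp (- (p * \<sigma> * \<bar>y\<bar>))))"
  have [measurable]: "case_prod G \<in> borel_measurable (borel \<Otimes>\<^sub>M borel)"
    unfolding G_def using weight_measurable[OF f \<open>0 < p\<close>] .
  have G: "ennreal (norm (f (Complex u y)) powr p * exp (- (p * \<sigma> * \<bar>y\<bar>))) = G y u" for y u
    by (simp add: G_def)
  have ind: "indicator {x - R..x + R} u = (indicator {u - R..u + R} x :: ennreal)" for x u
    by (auto simp: indicator_def)
  have eq: "weighted_area p \<sigma> f R x = (\<integral>\<^sup>+y. indicator {-R..R} y * (\<integral>\<^sup>+u. indicator {-R..R} (u - x) * G y u \<partial>lborel) \<partial>lborel)" for x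
    unfolding weighted_area_def G by (intro nn_integral_cong arg_cong2[where f="(*)"] refl) (auto simp: indicator_def)
  show "weighted_area p \<sigma> f R \<in> borel_measurable borel"
    unfolding eq[abs_def] by measurable
  have "(\<integral>\<^sup>+x. weighted_area p \<sigma> f R x \<partial>lborel)
     = (\<integral>\<^sup>+y. \<integral>\<^sup>+x. indicator {-R..R} y * (\<integral>\<^sup>+u. indicator {-R..R} (u - x) * G y u \<partial>lborel) \<partial>lborel \<partial>lborel)"
    unfolding eq by (rule lborel_pair.Fubini') measurable
  also have "\<dots> = (\<integral>\<^sup>+y. indicator {-R..R} y * (\<integral>\<^sup>+x. \<integral>\<^sup>+u. indicator {-R..R} (u - x) * G y u \<partial>lborel \<partial>lborel) \<partial>lborel)"
    by (intro nn_integral_cong nn_integral_cmult) measurable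
  also have "\<dots> = (\<integral>\<^sup>+y. indicator {-R..R} y * (\<integral>\<^sup>+u. \<integral>\<^sup>+x. indicator {-R..R} (u - x) * G y u \<partial>lborel \<partial>lborel) \<partial>lborel)"
    by (intro nn_integral_cong arg_cong2[where f="(*)"] refl lborel_pair.Fubini') measurable
  also have "\<dots> = (\<integral>\<^sup>+y. indicator {-R..R} y * (\<integral>\<^sup>+u. ennreal (2 * R) * G y u \<partial>lborel) \<partial>lborel)"
  proof (intro nn_integral_cong arg_cong2[where f="(*)"] refl)
    fix y u
    have "(\<integral>\<^sup>+x. indicator {-R..R} (u - x) * G y u \<partial>lborel) = (\<integral>\<^sup>+x. indicator {u - R..u + R} x \<partial>lborel) * G y u"
      by (subst nn_integral_multc[symmetric]) (auto intro!: nn_integral_cong simp: indicator_def)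
    then show "(\<integral>\<^sup>+x. indicator {-R..R} (u - x) * G y u \<partial>lborel) = ennreal (2 * R) * G y u"
      using \<open>0 < R\<close> by simp
  qed
  also have "\<dots> \<le> (\<integral>\<^sup>+y. indicator {-R..R} y * (ennreal (2 * R) * ennreal M) \<partial>lborel)"
  proof (intro nn_integral_mono mult_left_mono)
    fix y
    have "(\<integral>\<^sup>+u. ennreal (2 * R) * G y u \<partial>lborel) = ennreal (2 * R) * (\<integral>\<^sup>+u. G y u \<partial>lborel)"
      by (intro nn_integral_cmult) measurable
    also have "\<dots> \<le> ennreal (2 * R) * ennreal M"
      unfolding G_def by (intro mult_left_mono weighted_line_integral_le assms) auto
    finally show "(\<integral>\<^sup>+u. ennreal (2 * R) * G y u \<partial>lborel) \<le> ennreal (2 * R) * ennreal M" .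
  qed auto
  also have "\<dots> = ennreal (4 * R\<^sup>2 * M)"
    using \<open>0 < R\<close> \<open>0 < M\<close> by (simp add: nn_integral_multc power2_eq_square mult_ac flip: ennreal_mult)
  finally show "(\<integral>\<^sup>+x. weighted_area p \<sigma> f R x \<partial>lborel) \<le> ennreal (4 * R\<^sup>2 * M)" .
qed

lemma higher_deriv_sup_and_integral_bound:
  assumes "0 < p"
  obtains C where "0 < C"
    "\<And>f \<sigma> s x. f holomorphic_on UNIV \<Longrightarrow> exponential_type \<sigma> f \<Longrightarrow> 0 < \<sigma> \<Longrightarrow> 1 \<le> s \<Longrightarrow>
      (\<integral>\<^sup>+x. ennreal (norm (f (of_real x)) powr p) \<partial>lborel) \<le> 1 \<Longrightarrow>
      norm ((deriv ^^ s) f (of_real x)) \<le> C powr (1/p) * \<sigma> ^ s * (\<sigma> / real s) powr (1/p)"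
    "\<And>f \<sigma> s. f holomorphic_on UNIV \<Longrightarrow> exponential_type \<sigma> f \<Longrightarrow> 0 < \<sigma> \<Longrightarrow> 1 \<le> s \<Longrightarrow>
      (\<integral>\<^sup>+x. ennreal (norm (f (of_real x)) powr p) \<partial>lborel) \<le> 1 \<Longrightarrow>
      (\<integral>\<^sup>+x. ennreal (norm ((deriv ^^ s) f (of_real x)) powr p) \<partial>lborel) \<le> ennreal (C * \<sigma> powr (real s * p))"
proof -
  obtain C0 where C0: "0 < C0" and bound:
    "\<And>f \<sigma> s x. f holomorphic_on UNIV \<Longrightarrow> 0 < \<sigma> \<Longrightarrow> 1 \<le> s \<Longrightarrow>
      ennreal (norm ((deriv ^^ s) f (of_real x)) powr p)
      \<le> ennreal (C0 * \<sigma> powr (real s * p) / (real s / \<sigma>)\<^sup>2) * weighted_area p \<sigma> f (2 * (real s / \<sigma>)) x"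
    using higher_deriv_powr_le_weighted_area[OF \<open>0 < p\<close>] by blast
  show ?thesis
  proof (rule that[of "16 * C0"])
    show "0 < 16 * C0" using C0 by simp
    fix f \<sigma> and s :: nat
    assume f: "f holomorphic_on UNIV" "exponential_type \<sigma> f" and \<sigma>: "0 < \<sigma>" and s: "1 \<le> s"
      and le1: "(\<integral>\<^sup>+x. ennreal (norm (f (of_real x)) powr p) \<partial>lborel) \<le> 1"
    define r where "r = real s / \<sigma>"
    have r: "r > 0" using \<sigma> s by (simp add: r_def)
    define k where "k = C0 * \<sigma> powr (real s * p) / r\<^sup>2"
    have k: "0 < k" using C0 \<sigma> r by (simp add: k_def)
    have le1': "(\<integral>\<^sup>+x. ennreal (norm (f (of_real x)) powr p) \<partial>lborel) \<le> ennreal 1" using le1 by simp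
    note bnd = bound[OF f(1) \<sigma> s, folded r_def, folded k_def]
    show "norm ((deriv ^^ s) f (of_real x)) \<le> (16 * C0) powr (1/p) * \<sigma> ^ s * (\<sigma> / real s) powr (1/p)" for x
    proof -
      have "weighted_area p \<sigma> f (2 * r) x \<le> ennreal (2 * (2 * r) * 1)"
        using \<sigma> r by (intro weighted_area_le f \<open>0 < p\<close> le1') auto
      then have "ennreal k * weighted_area p \<sigma> f (2 * r) x \<le> ennreal k * ennreal (2 * (2 * r) * 1)"
        by (rule mult_left_mono) simp
      then have "ennreal (norm ((deriv ^^ s) f (of_real x)) powr p) \<le> ennreal k * ennreal (2 * (2 * r) * 1)"
        using bnd[of x] by (rule order.trans[rotated])
      also have "\<dots> = ennreal (4 * k * r)" using k r by (simp add: mult_ac flip: ennreal_mult)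
      finally have "norm ((deriv ^^ s) f (of_real x)) powr p \<le> 4 * k * r" using k r by (simp add: ennreal_le_iff)
      also have "4 * k * r = 4 * C0 * \<sigma> powr (real s * p) * (\<sigma> / real s)"
      proof -
        have "4 * k * r = 4 * C0 * \<sigma> powr (real s * p) * (1 / r)"
          using r by (simp add: k_def power2_eq_square)
        then show ?thesis by (simp add: r_def)
      qed
      also have "\<dots> \<le> 16 * C0 * \<sigma> powr (real s * p) * (\<sigma> / real s)"
        using C0 \<sigma> s by (intro mult_right_mono) auto
      finally have "(norm ((deriv ^^ s) f (of_real x)) powr p) powr (1/p) \<le> (16 * C0 * \<sigma> powr (real s * p) * (\<sigma> / real s)) powr (1/p)"
        using \<open>0 < p\<close> by (intro powr_mono2) auto
      also have "\<dots> = (16 * C0) powr (1/p) * (\<sigma> powr (real s * p)) powr (1/p) * (\<sigma> / real s) powr (1/p)"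
        by (simp only: powr_mult)
      also have "(\<sigma> powr (real s * p)) powr (1/p) = \<sigma> ^ s"
        using \<open>0 < p\<close> \<sigma> by (simp add: powr_powr powr_realpow)
      finally show ?thesis using \<open>0 < p\<close> by (simp add: powr_powr)
    qed
    have "(\<integral>\<^sup>+x. ennreal (norm ((deriv ^^ s) f (of_real x)) powr p) \<partial>lborel) \<le> (\<integral>\<^sup>+x. ennreal k * weighted_area p \<sigma> f (2 * r) x \<partial>lborel)"
      by (intro nn_integral_mono bnd)
    also have "\<dots> = ennreal k * (\<integral>\<^sup>+x. weighted_area p \<sigma> f (2 * r) x \<partial>lborel)"
    proof (rule nn_integral_cmult)
      have "weighted_area p \<sigma> f (2 * r) \<in> borel_measurable borel"
        using \<sigma> r by (intro integral_weighted_area_le(2)[of f \<sigma> p 1] f \<open>0 < p\<close> le1') auto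
      then show "weighted_area p \<sigma> f (2 * r) \<in> borel_measurable lborel" by simp
    qed
    also have "\<dots> \<le> ennreal k * ennreal (4 * (2 * r)\<^sup>2 * 1)"
      using \<sigma> r by (intro mult_left_mono integral_weighted_area_le(1) f \<open>0 < p\<close> le1') auto
    also have "\<dots> = ennreal (16 * C0 * \<sigma> powr (real s * p))"
    proof -
      have "k * (4 * (2 * r)\<^sup>2 * 1) = 16 * C0 * \<sigma> powr (real s * p)"
        using r by (simp add: k_def power_mult_distrib)
      moreover have "ennreal k * ennreal (4 * (2 * r)\<^sup>2 * 1) = ennreal (k * (4 * (2 * r)\<^sup>2 * 1))"
        by (rule ennreal_mult[symmetric]) (use k in auto)
      ultimately show ?thesis by (simp only:)
    qed
    finally show "(\<integral>\<^sup>+x. ennreal (norm ((deriv ^^ s) f (of_real x)) powr p) \<partial>lborel) \<le> ennreal (16 * C0 * \<sigma> powr (real s * p))" .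
  qed
qed

lemma Lp_norm_le:
  assumes "0 < q" "0 \<le> A" "(\<integral>\<^sup>+x. ennreal (norm (g x) powr q) \<partial>lborel) \<le> ennreal A"
  shows "Lp_norm (ennreal q) g \<le> ennreal (A powr (1/q))"
proof -
  let ?I = "\<integral>\<^sup>+x. ennreal (norm (g x) powr q) \<partial>lborel"
  have "?I < \<infinity>" using le_less_trans[OF assms(3) ennreal_less_top] by simp
  moreover from this have "enn2real ?I \<le> A"
    using enn2real_leI[OF assms(2,3)] by simp
  ultimately show ?thesis
    using assms(1) by (auto simp: Lp_norm_def Let_def intro!: ennreal_leI powr_mono2)
qed

lemma Lp_norm_ge:
  assumes "0 < q" "0 \<le> A" "ennreal A \<le> (\<integral>\<^sup>+x. ennreal (norm (g x) powr q) \<partial>lborel)"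
  shows "ennreal (A powr (1/q)) \<le> Lp_norm (ennreal q) g"
proof -
  let ?I = "\<integral>\<^sup>+x. ennreal (norm (g x) powr q) \<partial>lborel"
  show ?thesis
  proof (cases "?I = \<infinity>")
    case True
    then show ?thesis using assms(1) by (simp add: Lp_norm_def)
  next
    case False
    then have "?I = ennreal (enn2real ?I)" by (simp add: less_top)
    then have "ennreal A \<le> ennreal (enn2real ?I)" using assms(3) by simp
    then have "A \<le> enn2real ?I" by (simp add: ennreal_le_iff)
    then show ?thesis using False assms(1,2) by (auto simp: Lp_norm_def Let_def intro!: ennreal_leI powr_mono2)
  qed
qed

lemma integral_powr_of_Lp_norm_eq_1:
  assumes "0 < p" "Lp_norm (ennreal p) g = 1"
  shows "(\<integral>\<^sup>+x. ennreal (norm (g x) powr p) \<partial>lborel) = 1"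
proof -
  let ?I = "\<integral>\<^sup>+x. ennreal (norm (g x) powr p) \<partial>lborel"
  have fin: "?I \<noteq> \<infinity>" using assms by (auto simp: Lp_norm_def Let_def split: if_splits)
  then have "ennreal (enn2real ?I powr (1/p)) = 1" using assms by (simp add: Lp_norm_def Let_def)
  then have "enn2real ?I powr (1/p) = 1" by simp
  then have "(enn2real ?I powr (1/p)) powr p = 1" by simp
  then have "enn2real ?I = 1" using \<open>0 < p\<close> by (simp add: powr_powr)
  moreover have "?I = ennreal (enn2real ?I)" using fin by (simp add: less_top)
  ultimately show ?thesis by simp
qed

lemma enn2real_one_divide: "0 < p \<Longrightarrow> enn2real (1 / ennreal p) = 1 / p"
  using divide_ennreal[of 1 p] by (simp flip: ennreal_1)

lemma interpolation_exponents:
  fixes p u C \<sigma> t :: real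
  assumes "0 < p" "0 < u" "0 < C" "0 < \<sigma>" "0 < t"
  shows "((C powr (1/p) * \<sigma> ^ s * t powr (1/p)) powr (u - p) * (C * \<sigma> powr (real s * p))) powr (1/u)
    = C powr (1/p) * (\<sigma> ^ s * t powr (1/p - 1/u))"
proof -
  obtain a b c where e: "C = exp a" "\<sigma> = exp b" "t = exp c"
    using assms by (metis exp_ln)
  have "((a * (1/p) + real s * b + c * (1/p)) * (u - p) + (a + b * (real s * p))) * (1/u)
      = a * (1/p) + (real s * b + c * (1/p - 1/u))"
    using \<open>0 < p\<close> \<open>0 < u\<close> by (simp add: field_simps)
  then show ?thesis
    unfolding e by (simp only: exp_powr_real exp_of_nat_mult[symmetric] exp_add[symmetric])
qed

text \<open>
Interpolation between the uniform bound and the \<open>p\<close>-norm: \<open>\<bar>g\<bar> ^ q \<le> B ^ (q - p) \<bar>g\<bar> ^ p\<close> if \<open>\<bar>g\<bar> \<le> B\<close>.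
\<close>

lemma Lp_norm_higher_deriv_le:
  fixes q :: ennreal
  assumes "0 < p" "ennreal p < q"
  obtains C where "0 < C"
    "\<And>f \<sigma> s. f \<in> E_space \<sigma> (ennreal p) \<Longrightarrow> Lp_norm (ennreal p) (on_reals f) = 1 \<Longrightarrow> 0 < \<sigma> \<Longrightarrow> 1 \<le> s \<Longrightarrow>
      Lp_norm q (on_reals ((deriv ^^ s) f)) \<le> ennreal (C * (\<sigma> ^ s * (\<sigma> / real s) powr (1/p - enn2real (1/q))))"
proof -
  obtain C where C: "0 < C" and sup:
    "\<And>f \<sigma> s x. f holomorphic_on UNIV \<Longrightarrow> exponential_type \<sigma> f \<Longrightarrow> 0 < \<sigma> \<Longrightarrow> 1 \<le> s \<Longrightarrow>
      (\<integral>\<^sup>+x. ennreal (norm (f (of_real x)) powr p) \<partial>lborel) \<le> 1 \<Longrightarrow>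
      norm ((deriv ^^ s) f (of_real x)) \<le> C powr (1/p) * \<sigma> ^ s * (\<sigma> / real s) powr (1/p)"
    and int: "\<And>f \<sigma> s. f holomorphic_on UNIV \<Longrightarrow> exponential_type \<sigma> f \<Longrightarrow> 0 < \<sigma> \<Longrightarrow> 1 \<le> s \<Longrightarrow>
      (\<integral>\<^sup>+x. ennreal (norm (f (of_real x)) powr p) \<partial>lborel) \<le> 1 \<Longrightarrow>
      (\<integral>\<^sup>+x. ennreal (norm ((deriv ^^ s) f (of_real x)) powr p) \<partial>lborel) \<le> ennreal (C * \<sigma> powr (real s * p))"
    using higher_deriv_sup_and_integral_bound[OF \<open>0 < p\<close>] by blast
  show ?thesis
  proof (rule that[of "C powr (1/p)"])
    show "0 < C powr (1/p)" using C by simp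
    fix f \<sigma> and s :: nat
    assume E: "f \<in> E_space \<sigma> (ennreal p)" and one: "Lp_norm (ennreal p) (on_reals f) = 1"
      and \<sigma>: "0 < \<sigma>" and s: "1 \<le> s"
    have f: "f holomorphic_on UNIV" "exponential_type \<sigma> f" using E by (auto simp: E_space_def)
    have le1: "(\<integral>\<^sup>+x. ennreal (norm (f (of_real x)) powr p) \<partial>lborel) \<le> 1"
      using integral_powr_of_Lp_norm_eq_1[OF \<open>0 < p\<close> one] by simp
    define g where "g = (\<lambda>x. (deriv ^^ s) f (of_real x))"
    define B where "B = C powr (1/p) * \<sigma> ^ s * (\<sigma> / real s) powr (1/p)"
    have "B > 0" using C \<sigma> s by (simp add: B_def)
    have gB: "norm (g x) \<le> B" for x unfolding g_def B_def by (rule sup[OF f \<sigma> s le1])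
    have "(deriv ^^ s) f holomorphic_on UNIV" using f by (intro holomorphic_higher_deriv) auto
    from continuous_on_compose2[OF holomorphic_on_imp_continuous_on[OF this] continuous_on_of_real_id]
    have contg: "continuous_on UNIV g" unfolding g_def by simp
    then have [measurable]: "g \<in> borel_measurable borel" by (rule borel_measurable_continuous_onI)
    show "Lp_norm q (on_reals ((deriv ^^ s) f)) \<le> ennreal (C powr (1/p) * (\<sigma> ^ s * (\<sigma> / real s) powr (1/p - enn2real (1/q))))"
      unfolding g_def[symmetric]
    proof (cases "q = \<infinity>")
      case True
      have "esssup lborel (\<lambda>x. ennreal (norm (g x))) \<le> ennreal B"
        by (intro esssup_I AE_I2 ennreal_leI gB) measurable
      then show "Lp_norm q g \<le> ennreal (C powr (1/p) * (\<sigma> ^ s * (\<sigma> / real s) powr (1/p - enn2real (1/q))))"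
        using True by (simp add: Lp_norm_def B_def mult.assoc)
    next
      case False
      define u where "u = enn2real q"
      have q: "q = ennreal u" using False by (simp add: u_def less_top)
      have "p < u" using assms unfolding q by (simp add: ennreal_less_iff)
      then have "0 < u" using \<open>0 < p\<close> by simp
      have "(\<integral>\<^sup>+x. ennreal (norm (g x) powr u) \<partial>lborel) \<le> (\<integral>\<^sup>+x. ennreal (B powr (u - p)) * ennreal (norm (g x) powr p) \<partial>lborel)"
      proof (intro nn_integral_mono)
        fix x
        have "norm (g x) powr u = norm (g x) powr (u - p) * norm (g x) powr p"
          by (simp add: powr_add[symmetric])
        also have "\<dots> \<le> B powr (u - p) * norm (g x) powr p"
          using gB[of x] \<open>p < u\<close> by (intro mult_right_mono powr_mono2) auto
        finally show "ennreal (norm (g x) powr u) \<le> ennreal (B powr (u - p)) * ennreal (norm (g x) powr p)"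
          by (simp add: ennreal_leI flip: ennreal_mult)
      qed
      also have "\<dots> = ennreal (B powr (u - p)) * (\<integral>\<^sup>+x. ennreal (norm (g x) powr p) \<partial>lborel)"
        by (intro nn_integral_cmult) measurable
      also have "\<dots> \<le> ennreal (B powr (u - p)) * ennreal (C * \<sigma> powr (real s * p))"
        unfolding g_def by (intro mult_left_mono int[OF f \<sigma> s le1]) auto
      also have "\<dots> = ennreal (B powr (u - p) * (C * \<sigma> powr (real s * p)))"
        using C by (simp add: ennreal_mult)
      finally have "Lp_norm q g \<le> ennreal ((B powr (u - p) * (C * \<sigma> powr (real s * p))) powr (1/u))"
        unfolding q using C \<open>0 < u\<close> by (intro Lp_norm_le) auto
      also have "(B powr (u - p) * (C * \<sigma> powr (real s * p))) powr (1/u)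
          = C powr (1/p) * (\<sigma> ^ s * (\<sigma> / real s) powr (1/p - 1/u))"
        unfolding B_def using C \<sigma> s \<open>0 < p\<close> \<open>0 < u\<close> by (intro interpolation_exponents) auto
      finally show "Lp_norm q g \<le> ennreal (C powr (1/p) * (\<sigma> ^ s * (\<sigma> / real s) powr (1/p - enn2real (1/q))))"
        unfolding q enn2real_one_divide[OF \<open>0 < u\<close>] .
    qed
  qed
qed

section \<open>The lower bound\<close>

definition csinc :: "complex \<Rightarrow> complex" where
  "csinc z = (if z = 0 then 1 else sin z / z)"

lemma holomorphic_csinc: "csinc holomorphic_on UNIV"
proof (rule pole_theorem_open_0[where g = sin and a = 0])
  show "csinc 0 = deriv sin 0"
    using DERIV_imp_deriv[OF DERIV_sin[of "0 :: complex"]] by (simp add: csinc_def)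
qed (auto simp: csinc_def intro: holomorphic_intros)

lemma norm_sin_le_exp_Im: "norm (sin z :: complex) \<le> exp \<bar>Im z\<bar>"
proof -
  have "norm (sin z) = norm (exp (\<i> * z) - exp (- (\<i> * z))) / 2"
    by (simp add: sin_exp_eq norm_divide norm_mult)
  also have "\<dots> \<le> (norm (exp (\<i> * z)) + norm (exp (- (\<i> * z)))) / 2"
    by (intro divide_right_mono norm_triangle_ineq4) auto
  also have "\<dots> \<le> (exp \<bar>Im z\<bar> + exp \<bar>Im z\<bar>) / 2"
    by (intro divide_right_mono add_mono) auto
  finally show ?thesis by simp
qed

text \<open>
The quotient is controlled by the growth of the sine outside the unit disc and by compactness inside it.
\<close>

lemma csinc_bound:
  obtains C where "1 \<le> C" "\<And>z. norm (csinc z) \<le> C * exp \<bar>Im z\<bar>"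
proof -
  have "continuous_on (cball 0 1) csinc"
    by (rule holomorphic_on_imp_continuous_on[OF holomorphic_on_subset[OF holomorphic_csinc subset_UNIV]])
  then have "bounded (csinc ` cball 0 1)"
    by (intro compact_imp_bounded compact_continuous_image) auto
  then obtain B where "\<forall>w\<in>csinc ` cball 0 1. norm w \<le> B"
    unfolding bounded_iff by blast
  then have B: "norm (csinc z) \<le> B" if "z \<in> cball 0 1" for z using that by blast
  have "norm (csinc z) \<le> max 1 B * exp \<bar>Im z\<bar>" for z
  proof (cases "norm z \<le> 1")
    case True
    have "norm (csinc z) \<le> max 1 B * 1" using B[of z] True by simp
    also have "\<dots> \<le> max 1 B * exp \<bar>Im z\<bar>" by (intro mult_left_mono) auto
    finally show ?thesis .
  next
    case False
    then have z0: "z \<noteq> 0" by auto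
    have "norm (csinc z) = norm (sin z) / norm z" using z0 by (simp add: csinc_def norm_divide)
    also have "\<dots> \<le> norm (sin z) / 1" using False by (intro divide_left_mono) auto
    also have "\<dots> \<le> 1 * exp \<bar>Im z\<bar>" using norm_sin_le_exp_Im[of z] by simp
    also have "\<dots> \<le> max 1 B * exp \<bar>Im z\<bar>" by (intro mult_right_mono) auto
    finally show ?thesis .
  qed
  then show ?thesis using that[of "max 1 B"] by simp
qed

text \<open>
A power of \<open>sin z / z\<close> with exponent \<open>n \<ge> 2 / p\<close>: on the real line its \<open>p\<close>-th power decays at least like
\<open>1 / (1 + x\<^sup>2)\<close>.
\<close>

lemma integrable_band_limited_function:
  assumes "0 < p"
  obtains g :: "complex \<Rightarrow> complex" and G m I \<delta> :: real
  where "g holomorphic_on UNIV" "0 < G" "0 < m" "0 < I" "0 < \<delta>"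
    "\<And>z. norm (g z) \<le> G * exp (m * \<bar>Im z\<bar>)"
    "(\<integral>\<^sup>+x. ennreal (norm (g (of_real x)) powr p) \<partial>lborel) = ennreal I"
    "\<And>x. \<bar>x\<bar> \<le> \<delta> \<Longrightarrow> 1/2 \<le> norm (g (of_real x))"
proof -
  obtain C where C: "1 \<le> C" "\<And>z. norm (csinc z) \<le> C * exp \<bar>Im z\<bar>" by (rule csinc_bound) blast
  define n where "n = nat \<lceil>2 / p\<rceil>"
  have "2 / p \<le> real n" unfolding n_def by linarith
  then have np: "2 \<le> real n * p" using \<open>0 < p\<close> by (simp add: field_simps)
  then have "n > 0" by (cases n) auto
  define g where "g = (\<lambda>z. csinc z ^ n)"
  have hol: "g holomorphic_on UNIV" unfolding g_def by (intro holomorphic_intros holomorphic_csinc)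
  have bound: "norm (g z) \<le> C ^ n * exp (real n * \<bar>Im z\<bar>)" for z
  proof -
    have "norm (g z) \<le> (C * exp \<bar>Im z\<bar>) ^ n" unfolding g_def norm_power by (intro power_mono C) auto
    then show ?thesis by (simp add: power_mult_distrib exp_of_nat_mult)
  qed
  have contg: "continuous_on UNIV (\<lambda>x. g (of_real x))"
    by (rule continuous_on_compose2[OF holomorphic_on_imp_continuous_on[OF hol] continuous_on_of_real_id]) simp
  then have [measurable]: "(\<lambda>x. g (of_real x)) \<in> borel_measurable borel"
    by (rule borel_measurable_continuous_onI)
  have decay: "norm (g (of_real x)) powr p \<le> (C\<^sup>2 + 1) powr (real n * p / 2) * inverse (1 + x\<^sup>2)" for x :: real
  proof -
    define h where "h = norm (csinc (of_real x))"
    have "h\<^sup>2 \<le> C\<^sup>2" unfolding h_def using C(2)[of "of_real x"] by (intro power_mono) auto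
    moreover have "(x * h)\<^sup>2 \<le> 1"
    proof -
      have "\<bar>x\<bar> * h \<le> 1"
      proof (cases "x = 0")
        case False
        have "norm (sin (of_real x :: complex)) = \<bar>sin x\<bar>" by (simp only: sin_of_real norm_of_real)
        then show ?thesis using False by (simp add: h_def csinc_def norm_divide)
      qed simp
      then have "(\<bar>x\<bar> * h)\<^sup>2 \<le> 1" by (intro power_le_one) (auto simp: h_def)
      then show ?thesis by (simp add: power_mult_distrib)
    qed
    ultimately have "h\<^sup>2 * (1 + x\<^sup>2) \<le> C\<^sup>2 + 1" by (simp add: power_mult_distrib algebra_simps)
    then have h2: "h\<^sup>2 \<le> (C\<^sup>2 + 1) / (1 + x\<^sup>2)" by (simp add: field_simps add_pos_nonneg)
    have "norm (g (of_real x)) powr p = (h ^ n) powr p" by (simp add: g_def h_def norm_power)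
    also have "h ^ n = h powr real n"
      using powr_realpow'[of h n] \<open>n > 0\<close> by (simp add: h_def)
    also have "\<dots> powr p = h powr (2 * (real n * p / 2))" by (simp add: powr_powr)
    also have "\<dots> = (h powr 2) powr (real n * p / 2)" by (simp only: powr_powr)
    also have "\<dots> = (h\<^sup>2) powr (real n * p / 2)" using powr_realpow'[of h 2] by (simp add: h_def)
    also have "\<dots> \<le> ((C\<^sup>2 + 1) / (1 + x\<^sup>2)) powr (real n * p / 2)"
      using h2 np by (intro powr_mono2) auto
    also have "\<dots> = (C\<^sup>2 + 1) powr (real n * p / 2) / (1 + x\<^sup>2) powr (real n * p / 2)"
      by (rule powr_divide)
    also have "\<dots> \<le> (C\<^sup>2 + 1) powr (real n * p / 2) / (1 + x\<^sup>2) powr 1"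
    proof (rule divide_left_mono)
      have pos: "0 < 1 + x\<^sup>2" by (simp add: add_pos_nonneg)
      show "(1 + x\<^sup>2) powr 1 \<le> (1 + x\<^sup>2) powr (real n * p / 2)" using np by (intro powr_mono) auto
      have "0 < (1 + x\<^sup>2) powr e" for e
        using pos powr_gt_zero[of "1 + x\<^sup>2" e] by linarith
      then show "0 < (1 + x\<^sup>2) powr (real n * p / 2) * (1 + x\<^sup>2) powr 1"
        using mult_pos_pos by blast
    qed simp
    also have "(1 + x\<^sup>2) powr 1 = 1 + x\<^sup>2" by (simp add: add_nonneg_nonneg)
    finally show ?thesis by (simp only: divide_inverse)
  qed
  define J where "J = (\<integral>\<^sup>+x. ennreal (norm (g (of_real x)) powr p) \<partial>lborel)"
  have "J < \<infinity>"
  proof -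
    have "J \<le> (\<integral>\<^sup>+x. ennreal ((C\<^sup>2 + 1) powr (real n * p / 2) * inverse (1 + x\<^sup>2)) \<partial>lborel)"
      unfolding J_def by (rule nn_integral_mono, rule ennreal_leI, rule decay)
    also have "\<dots> < \<infinity>"
    proof -
      have "integrable lborel (\<lambda>x::real. (C\<^sup>2 + 1) powr (real n * p / 2) * inverse (1 + x\<^sup>2))"
        using integrable_inverse_1_plus_square by (simp add: set_integrable_def)
      then show ?thesis by (subst nn_integral_eq_integral) auto
    qed
    finally show ?thesis .
  qed
  have "g 0 = 1" by (simp add: g_def csinc_def)
  have "isCont (\<lambda>x. g (of_real x)) 0" using contg unfolding continuous_on_eq_continuous_at[OF open_UNIV] by blast
  then have "\<exists>d>0. \<forall>x. dist x 0 < d \<longrightarrow> dist (g (of_real x)) (g (of_real 0)) < 1/2"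
    unfolding continuous_at_eps_delta by (rule allE[where x = "1/2"]) simp
  then obtain d where d: "d > 0" "\<And>x. \<bar>x\<bar> < d \<Longrightarrow> dist (g (of_real x)) 1 < 1/2"
    using \<open>g 0 = 1\<close> by (auto simp: dist_real_def)
  define \<delta> where "\<delta> = d / 2"
  have \<delta>: "\<delta> > 0" using d by (simp add: \<delta>_def)
  have big: "1/2 \<le> norm (g (of_real x))" if "\<bar>x\<bar> \<le> \<delta>" for x
  proof -
    have "dist (g (of_real x)) 1 < 1/2" using d that by (intro d(2)) (auto simp: \<delta>_def)
    then show ?thesis using norm_triangle_ineq2[of 1 "g (of_real x)"] by (simp add: dist_norm norm_minus_commute)
  qed
  have "0 < J"
  proof -
    have "0 < ennreal ((1/2) powr p) * ennreal (2 * \<delta>)" using \<delta> by (simp add: ennreal_zero_less_mult_iff)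
    also have "\<dots> = (\<integral>\<^sup>+x. ennreal ((1/2) powr p) * indicator {-\<delta>..\<delta>} x \<partial>lborel)"
      using \<delta> by (subst nn_integral_cmult_indicator) auto
    also have "\<dots> \<le> J"
      unfolding J_def
    proof (intro nn_integral_mono)
      fix x
      show "ennreal ((1/2) powr p) * indicator {-\<delta>..\<delta>} x \<le> ennreal (norm (g (of_real x)) powr p)"
        using big[of x] \<open>0 < p\<close> by (auto simp: indicator_def abs_le_iff intro!: ennreal_leI powr_mono2)
    qed
    finally show ?thesis .
  qed
  have J: "J = ennreal (enn2real J)" using \<open>J < \<infinity>\<close> by simp
  have "0 < enn2real J" using \<open>0 < J\<close> \<open>J < \<infinity>\<close> by (simp add: enn2real_positive_iff)
  show ?thesis
  proof (rule that[of g "C ^ n" "real n" "enn2real J" \<delta>])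
    show "(\<integral>\<^sup>+x. ennreal (norm (g (of_real x)) powr p) \<partial>lborel) = ennreal (enn2real J)"
      using J unfolding J_def .
    show "0 < C ^ n" using C(1) by simp
    show "norm (g z) \<le> C ^ n * exp (real n * \<bar>Im z\<bar>)" for z by (rule bound)
    show "1/2 \<le> norm (g (of_real x))" if "\<bar>x\<bar> \<le> \<delta>" for x using that by (rule big)
  qed (use hol \<open>n > 0\<close> \<delta> \<open>0 < enn2real J\<close> in simp_all)
qed

text \<open>
In Leibniz' formula the term in which every derivative falls on the exponential has modulus \<open>a ^ s\<close> times
\<open>\<bar>g (b x)\<bar>\<close>. Cauchy's estimate on unit discs bounds the \<open>k\<close>-th derivative of \<open>g\<close> by \<open>k! G\<close>, and
\<open>(s choose k) k! \<le> s ^ k\<close>.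
\<close>

lemma higher_deriv_modulated_ge:
  assumes g: "g holomorphic_on UNIV" and bd: "\<And>z. \<bar>Im z\<bar> \<le> 1 \<Longrightarrow> norm (g z) \<le> G"
    and "0 \<le> a" "0 \<le> b"
  shows "a ^ s * norm (g (of_real (b * x))) - G * (\<Sum>k=1..s. (real s * b) ^ k * a ^ (s - k))
    \<le> norm ((deriv ^^ s) (\<lambda>z. g (of_real b * z) * exp (\<i> * of_real a * z)) (of_real x))"
proof -
  let ?x = "of_real x :: complex"
  define T where "T = (\<lambda>k. of_nat (s choose k) * (deriv ^^ k) (\<lambda>z. g (of_real b * z)) ?x *
    (deriv ^^ (s - k)) (\<lambda>z. exp (\<i> * of_real a * z)) ?x)"
  have h1: "(\<lambda>z. g (of_real b * z)) holomorphic_on UNIV"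
    by (intro holomorphic_on_compose_gen[OF _ g, unfolded o_def] holomorphic_intros) auto
  have dg: "(deriv ^^ k) (\<lambda>z. g (of_real b * z)) ?x = of_real b ^ k * (deriv ^^ k) g (of_real (b * x))" for k
    using higher_deriv_compose_linear[OF g open_UNIV open_UNIV, of ?x "of_real b" k] by simp
  have de: "norm ((deriv ^^ k) (\<lambda>z. exp (\<i> * of_real a * z)) ?x) = a ^ k" for k
  proof -
    have "deriv exp = (exp :: complex \<Rightarrow> complex)"
      by (rule ext) (rule DERIV_imp_deriv[OF DERIV_exp])
    then have "(deriv ^^ k) exp = (exp :: complex \<Rightarrow> complex)"
      by (induction k) simp_all
    then have "(deriv ^^ k) (\<lambda>z. exp (\<i> * of_real a * z)) ?x = (\<i> * of_real a) ^ k * exp (\<i> * of_real a * ?x)"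
      using higher_deriv_compose_linear[OF holomorphic_on_exp[of UNIV] open_UNIV open_UNIV, of ?x "\<i> * of_real a" k] by simp
    then show ?thesis using \<open>0 \<le> a\<close> by (simp add: norm_mult norm_power)
  qed
  have "(deriv ^^ s) (\<lambda>z. g (of_real b * z) * exp (\<i> * of_real a * z)) ?x = (\<Sum>k=0..s. T k)"
    unfolding T_def by (intro higher_deriv_mult[OF h1 _ open_UNIV]) (auto intro!: holomorphic_intros)
  also have "\<dots> = T 0 + (\<Sum>k=1..s. T k)" by (simp add: sum.atLeast_Suc_atMost)
  finally have split: "(deriv ^^ s) (\<lambda>z. g (of_real b * z) * exp (\<i> * of_real a * z)) ?x = T 0 + (\<Sum>k=1..s. T k)" .
  have T0: "norm (T 0) = a ^ s * norm (g (of_real (b * x)))"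
    using dg[of 0] de[of s] by (simp add: T_def norm_mult mult.commute)
  have "norm (\<Sum>k=1..s. T k) \<le> (\<Sum>k=1..s. G * ((real s * b) ^ k * a ^ (s - k)))"
  proof (rule sum_norm_le)
    fix k
    have "norm ((deriv ^^ k) g (of_real (b * x))) \<le> fact k * G / 1 ^ k"
    proof (rule Cauchy_inequality)
      show "norm (g z) \<le> G" if "norm (of_real (b * x) - z) = 1" for z
        using bd[of z] abs_Im_le_cmod[of "of_real (b * x) - z"] that by simp
      show "g holomorphic_on ball (of_real (b * x)) 1" by (rule holomorphic_on_subset[OF g subset_UNIV])
      show "continuous_on (cball (of_real (b * x)) 1) g"
        by (rule holomorphic_on_imp_continuous_on[OF holomorphic_on_subset[OF g subset_UNIV]])
    qed simp
    then have dG: "norm ((deriv ^^ k) g (of_real (b * x))) \<le> fact k * G" by simp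
    have G: "0 \<le> G" using order.trans[OF norm_ge_zero bd[of 0]] by simp
    have "real ((s choose k) * fact k) \<le> real (s ^ k)" using binomial_fact_pow of_nat_le_iff by blast
    then have bin: "real (s choose k) * fact k \<le> real s ^ k" by simp
    have "norm (T k) = real (s choose k) * (b ^ k * norm ((deriv ^^ k) g (of_real (b * x)))) * a ^ (s - k)"
      unfolding T_def dg using \<open>0 \<le> b\<close> by (simp add: norm_mult norm_power de)
    also have "\<dots> \<le> real (s choose k) * (b ^ k * (fact k * G)) * a ^ (s - k)"
      using \<open>0 \<le> a\<close> \<open>0 \<le> b\<close> dG by (intro mult_right_mono mult_left_mono) auto
    also have "\<dots> = (real (s choose k) * fact k) * (b ^ k * G * a ^ (s - k))" by simp
    also have "\<dots> \<le> real s ^ k * (b ^ k * G * a ^ (s - k))"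
      using \<open>0 \<le> a\<close> \<open>0 \<le> b\<close> G by (intro mult_right_mono bin) auto
    finally show "norm (T k) \<le> G * ((real s * b) ^ k * a ^ (s - k))"
      by (simp add: power_mult_distrib mult_ac)
  qed
  moreover have "norm (T 0) \<le> norm (T 0 + (\<Sum>k=1..s. T k)) + norm (\<Sum>k=1..s. T k)"
    using norm_triangle_ineq4[of "T 0 + (\<Sum>k=1..s. T k)" "\<Sum>k=1..s. T k"] by simp
  ultimately show ?thesis unfolding split T0 by (simp add: sum_distrib_left)
qed

lemma esssup_ge_on_interval:
  fixes h :: "real \<Rightarrow> ennreal"
  assumes "0 < c" "\<And>x. \<bar>x\<bar> \<le> c \<Longrightarrow> v \<le> h x"
  shows "v \<le> esssup lborel h"
proof (rule ccontr)
  assume "\<not> v \<le> esssup lborel h"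
  then have lt: "esssup lborel h < v" by simp
  have "AE x in lborel. x \<notin> {-c..c}"
    using esssup_AE[of h lborel]
  proof (rule AE_mp, intro AE_I2 impI)
    fix x assume "h x \<le> esssup lborel h"
    then have "h x < v" using lt by (rule le_less_trans)
    then have "\<not> \<bar>x\<bar> \<le> c" using assms(2)[of x] leD by blast
    then show "x \<notin> {-c..c}" by (auto simp: abs_le_iff)
  qed
  then have "{-c..c} \<in> null_sets lborel" by (subst AE_iff_null_sets) auto
  then have "emeasure lborel {-c..c} = 0" by (rule null_setsD1)
  then show False using \<open>0 < c\<close> by simp
qed

lemma Lp_norm_ge_on_interval:
  assumes "0 < q" "0 < c" "0 \<le> v" "\<And>x. \<bar>x\<bar> \<le> c \<Longrightarrow> v \<le> norm (h x)"
  shows "ennreal (v * (2 * c) powr enn2real (1/q)) \<le> Lp_norm q h"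
proof (cases "q = \<infinity>")
  case True
  have "ennreal v \<le> esssup lborel (\<lambda>x. ennreal (norm (h x)))"
    using assms by (intro esssup_ge_on_interval[of c] ennreal_leI) auto
  then show ?thesis using True \<open>0 < c\<close> by (simp add: Lp_norm_def)
next
  case False
  define u where "u = enn2real q"
  have q: "q = ennreal u" using False by (simp add: u_def less_top)
  have "0 < u" using \<open>0 < q\<close> unfolding q by simp
  have "ennreal (v powr u * (2 * c)) = ennreal (v powr u) * ennreal (2 * c)"
    using \<open>0 < c\<close> by (simp add: ennreal_mult)
  also have "\<dots> = (\<integral>\<^sup>+x. ennreal (v powr u) * indicator {-c..c} x \<partial>lborel)"
    using \<open>0 < c\<close> by (subst nn_integral_cmult_indicator) auto
  also have "\<dots> \<le> (\<integral>\<^sup>+x. ennreal (norm (h x) powr u) \<partial>lborel)"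
  proof (rule nn_integral_mono)
    fix x
    show "ennreal (v powr u) * indicator {-c..c} x \<le> ennreal (norm (h x) powr u)"
    proof (cases "\<bar>x\<bar> \<le> c")
      case True
      then have "ennreal (v powr u) \<le> ennreal (norm (h x) powr u)"
        using assms \<open>0 < u\<close> by (intro ennreal_leI powr_mono2) auto
      then show ?thesis by (simp add: indicator_def)
    next
      case False
      then show ?thesis by (auto simp: indicator_def)
    qed
  qed
  finally have "ennreal ((v powr u * (2 * c)) powr (1/u)) \<le> Lp_norm q h"
    unfolding q using \<open>0 < u\<close> \<open>0 < c\<close> by (intro Lp_norm_ge) auto
  moreover have "(v powr u * (2 * c)) powr (1/u) = v * (2 * c) powr (1/u)"
    using \<open>0 < u\<close> \<open>0 \<le> v\<close> by (simp add: powr_mult powr_powr)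
  ultimately show ?thesis unfolding q enn2real_one_divide[OF \<open>0 < u\<close>] by simp
qed

lemma sum_powers_le:
  fixes \<beta> :: real
  assumes "0 \<le> \<beta>" "\<beta> \<le> 1/2"
  shows "(\<Sum>k=1..n. \<beta> ^ k) \<le> 2 * \<beta>"
proof -
  have "(\<Sum>k=1..n. \<beta> ^ k) + 2 * \<beta> ^ Suc n \<le> 2 * \<beta>"
  proof (induction n)
    case (Suc n)
    have "2 * \<beta> ^ Suc (Suc n) \<le> \<beta> ^ Suc n"
      using mult_right_mono[OF assms(2), of "\<beta> ^ Suc n"] assms(1) by simp
    moreover have "(\<Sum>k=1..Suc n. \<beta> ^ k) = (\<Sum>k=1..n. \<beta> ^ k) + \<beta> ^ Suc n" by simp
    ultimately show ?case using Suc.IH by linarith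
  qed simp
  moreover have "0 \<le> 2 * \<beta> ^ Suc n" using assms(1) by simp
  ultimately show ?thesis by linarith
qed

text \<open>
With \<open>b = \<beta> \<sigma> / s\<close> the Leibniz terms form a geometric series with ratio \<open>\<beta>\<close>, so that a small \<open>\<beta>\<close> leaves the
leading term dominant wherever \<open>\<bar>g (b x)\<bar> \<ge> 1/2\<close>.
\<close>

lemma Lp_norm_higher_deriv_ge:
  fixes q :: ennreal
  assumes "0 < p" "0 < q"
  obtains C where "0 < C"
    "\<And>\<sigma> s. 0 < \<sigma> \<Longrightarrow> 1 \<le> s \<Longrightarrow> \<exists>f\<in>E_space \<sigma> (ennreal p). Lp_norm (ennreal p) (on_reals f) = 1 \<and>
      ennreal (C * (\<sigma> ^ s * (\<sigma> / real s) powr (1/p - enn2real (1/q)))) \<le> Lp_norm q (on_reals ((deriv ^^ s) f))"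
proof -
  obtain g :: "complex \<Rightarrow> complex" and G m I \<delta> :: real
    where g: "g holomorphic_on UNIV" and pos: "0 < G" "0 < m" "0 < I" "0 < \<delta>"
      and growth: "\<And>z. norm (g z) \<le> G * exp (m * \<bar>Im z\<bar>)"
      and int: "(\<integral>\<^sup>+x. ennreal (norm (g (of_real x)) powr p) \<partial>lborel) = ennreal I"
      and big: "\<And>x. \<bar>x\<bar> \<le> \<delta> \<Longrightarrow> 1/2 \<le> norm (g (of_real x))"
    using integrable_band_limited_function[OF \<open>0 < p\<close>] by blast
  define K where "K = G * exp m"
  have "0 < K" using pos by (simp add: K_def)
  \<comment> \<open>The bounds on \<open>\<beta>\<close> sum the series, keep \<open>a ^ s \<ge> \<sigma> ^ s / 2\<close>, and make the tail at most half of the leading term.\<close>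
  define \<beta> where "\<beta> = min (1/2) (min (1 / (2 * m)) (1 / (16 * K)))"
  have "0 < \<beta>" "\<beta> \<le> 1/2" using pos \<open>0 < K\<close> by (auto simp: \<beta>_def)
  have "\<beta> \<le> 1 / (2 * m)" "\<beta> \<le> 1 / (16 * K)" by (auto simp: \<beta>_def)
  then have "m * \<beta> \<le> 1/2" "K * (2 * \<beta>) \<le> 1/8" using pos \<open>0 < K\<close> by (simp_all add: field_simps)
  note \<beta> = \<open>0 < \<beta>\<close> \<open>\<beta> \<le> 1/2\<close> \<open>m * \<beta> \<le> 1/2\<close> \<open>K * (2 * \<beta>) \<le> 1/8\<close>
  define \<theta> where "\<theta> = enn2real (1/q)"
  define C where "C = 1/8 * (1/I) powr (1/p) * (2 * \<delta>) powr \<theta> * \<beta> powr (1/p - \<theta>)"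
  have contg: "continuous_on UNIV (\<lambda>x. norm (g (of_real x)) powr p)"
    using \<open>0 < p\<close> continuous_on_compose2[OF holomorphic_on_imp_continuous_on[OF g] continuous_on_of_real_id]
    by (intro continuous_on_powr' continuous_on_norm continuous_on_const) auto
  then have [measurable]: "(\<lambda>x. norm (g (of_real x)) powr p) \<in> borel_measurable borel"
    by (rule borel_measurable_continuous_onI)
  show ?thesis
  proof (rule that[of C])
    show "0 < C" using pos \<beta> by (simp add: C_def)
    fix \<sigma> :: real and s :: nat
    assume \<sigma>: "0 < \<sigma>" and s: "1 \<le> s"
    define b where "b = \<beta> * (\<sigma> / real s)"
    define a where "a = \<sigma> - m * b"
    \<comment> \<open>This factor gives \<open>f\<close> unit norm.\<close>
    define A where "A = (b / I) powr (1/p)"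
    have b: "0 < b" "real s * b = \<beta> * \<sigma>" using \<sigma> s \<beta> by (auto simp: b_def)
    have a_eq: "a = \<sigma> * (1 - m * \<beta> / real s)" by (simp add: a_def b_def algebra_simps)
    have small: "m * \<beta> / real s \<le> 1/2"
    proof -
      have "m * \<beta> / real s \<le> m * \<beta> / 1" using s \<beta> pos by (intro divide_left_mono) auto
      then show ?thesis using \<beta>(3) unfolding div_by_1 by (rule order.trans)
    qed
    then have small1: "m * \<beta> / real s \<le> 1" by linarith
    have a: "0 \<le> a" "a \<le> \<sigma>" "\<sigma> ^ s / 2 \<le> a ^ s"
    proof -
      show "0 \<le> a" unfolding a_eq using small1 \<sigma> by (intro mult_nonneg_nonneg) auto
      show "a \<le> \<sigma>" unfolding a_def using b pos by simp
      have "1/2 \<le> 1 + real s * (- (m * \<beta> / real s))" using \<beta> s by simp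
      also have "\<dots> \<le> (1 + (- (m * \<beta> / real s))) ^ s"
        using small1 by (intro Bernoulli_inequality) auto
      finally have "\<sigma> ^ s * (1/2) \<le> \<sigma> ^ s * (1 + (- (m * \<beta> / real s))) ^ s"
        using \<sigma> by (intro mult_left_mono) auto
      then show "\<sigma> ^ s / 2 \<le> a ^ s" by (simp add: a_eq power_mult_distrib)
    qed
    have A: "0 < A" using b pos by (simp add: A_def)
    define gA where "gA = (\<lambda>z. of_real A * g z)"
    define f where "f = (\<lambda>z. gA (of_real b * z) * exp (\<i> * of_real a * z))"
    have gA: "gA holomorphic_on UNIV" unfolding gA_def by (intro holomorphic_intros g)
    have f: "f holomorphic_on UNIV"
      unfolding f_def
      by (intro holomorphic_on_mult holomorphic_on_compose_gen[OF _ gA, unfolded o_def] holomorphic_intros) auto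
    have f_growth: "norm (f z) \<le> A * G * exp (\<sigma> * \<bar>Im z\<bar>)" for z
    proof -
      have "norm (f z) = A * norm (g (of_real b * z)) * exp (- (a * Im z))"
        using A by (simp add: f_def gA_def norm_mult)
      also have "\<dots> \<le> A * (G * exp (m * (b * \<bar>Im z\<bar>))) * exp (a * \<bar>Im z\<bar>)"
      proof (intro mult_mono)
        show "norm (g (of_real b * z)) \<le> G * exp (m * (b * \<bar>Im z\<bar>))"
          using growth[of "of_real b * z"] b by (simp add: abs_mult)
        show "exp (- (a * Im z)) \<le> exp (a * \<bar>Im z\<bar>)"
          using mult_left_mono[OF abs_ge_minus_self[of "Im z"] a(1)] by simp
      qed (use A pos in auto)
      also have "\<dots> = A * G * exp (\<sigma> * \<bar>Im z\<bar>)"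
        by (simp add: a_def algebra_simps flip: exp_add)
      finally show ?thesis .
    qed
    have "exponential_type \<sigma> f"
      unfolding exponential_type_def
    proof (intro allI impI exI)
      fix \<epsilon> :: real and z :: complex assume "0 < \<epsilon>"
      have "\<sigma> * \<bar>Im z\<bar> \<le> (\<sigma> + \<epsilon>) * norm z"
        using \<sigma> \<open>0 < \<epsilon>\<close> abs_Im_le_cmod[of z] by (intro mult_mono) auto
      then have "A * G * exp (\<sigma> * \<bar>Im z\<bar>) \<le> A * G * exp ((\<sigma> + \<epsilon>) * norm z)"
        using A pos by (intro mult_left_mono) auto
      with f_growth[of z] show "norm (f z) \<le> A * G * exp ((\<sigma> + \<epsilon>) * norm z)" by (rule order.trans)
    qed
    have f_real: "norm (f (of_real x)) powr p = b / I * norm (g (of_real (b * x))) powr p" for x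
    proof -
      have "norm (f (of_real x)) = A * norm (g (of_real (b * x)))"
        using A by (simp add: f_def gA_def norm_mult)
      moreover have "A powr p = b / I" using b pos \<open>0 < p\<close> by (simp add: A_def powr_powr)
      ultimately show ?thesis by (simp add: powr_mult)
    qed
    have int_f: "(\<integral>\<^sup>+x. ennreal (norm (f (of_real x)) powr p) \<partial>lborel) = 1"
    proof -
      define X where "X = (\<integral>\<^sup>+x. ennreal (norm (g (of_real (b * x))) powr p) \<partial>lborel)"
      have "ennreal I = ennreal b * X"
        using nn_integral_real_affine[of "\<lambda>x. ennreal (norm (g (of_real x)) powr p)" b 0] b(1)
        unfolding int X_def by simp
      have "(\<integral>\<^sup>+x. ennreal (norm (f (of_real x)) powr p) \<partial>lborel)
          = (\<integral>\<^sup>+x. ennreal (b / I) * ennreal (norm (g (of_real (b * x))) powr p) \<partial>lborel)"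
        unfolding f_real using b pos by (intro nn_integral_cong ennreal_mult) auto
      also have "\<dots> = ennreal (b / I) * X"
        unfolding X_def
      proof (rule nn_integral_cmult)
        have "(\<lambda>x. norm (g (of_real (b * x))) powr p) \<in> borel_measurable borel"
          using measurable_compose[of "\<lambda>x. b * x" borel borel "\<lambda>x. norm (g (of_real x)) powr p" borel] by simp
        then show "(\<lambda>x. ennreal (norm (g (of_real (b * x))) powr p)) \<in> borel_measurable lborel" by simp
      qed
      also have "ennreal (b / I) = ennreal (1 / I) * ennreal b"
        using b pos by (simp flip: ennreal_mult)
      also have "ennreal (1 / I) * ennreal b * X = ennreal (1 / I) * ennreal I"
        unfolding \<open>ennreal I = ennreal b * X\<close> by (rule mult.assoc)
      also have "\<dots> = 1" using pos by (simp flip: ennreal_mult)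
      finally show ?thesis .
    qed
    have norm_f: "Lp_norm (ennreal p) (on_reals f) = 1"
      using int_f \<open>0 < p\<close> by (simp add: Lp_norm_def)
    have lower: "A * \<sigma> ^ s / 8 \<le> norm ((deriv ^^ s) f (of_real x))" if x: "\<bar>x\<bar> \<le> \<delta> / b" for x
    proof -
      have bx: "\<bar>b * x\<bar> \<le> \<delta>" using x b by (simp add: abs_mult field_simps)
      have "(\<Sum>k=1..s. (real s * b) ^ k * a ^ (s - k)) \<le> (\<Sum>k=1..s. \<sigma> ^ s * \<beta> ^ k)"
      proof (rule sum_mono)
        fix k assume k: "k \<in> {1..s}"
        have "(real s * b) ^ k * a ^ (s - k) \<le> (\<beta> * \<sigma>) ^ k * \<sigma> ^ (s - k)"
          unfolding b(2) using a \<beta> \<sigma> by (intro mult_left_mono power_mono) auto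
        also have "\<dots> = \<sigma> ^ s * \<beta> ^ k" using k by (simp add: power_mult_distrib flip: power_add)
        finally show "(real s * b) ^ k * a ^ (s - k) \<le> \<sigma> ^ s * \<beta> ^ k" .
      qed
      also have "\<dots> = \<sigma> ^ s * (\<Sum>k=1..s. \<beta> ^ k)" by (simp add: sum_distrib_left)
      also have "\<dots> \<le> \<sigma> ^ s * (2 * \<beta>)" using \<sigma> \<beta> by (intro mult_left_mono sum_powers_le) auto
      finally have "A * K * (\<Sum>k=1..s. (real s * b) ^ k * a ^ (s - k)) \<le> A * K * (\<sigma> ^ s * (2 * \<beta>))"
        using A \<open>0 < K\<close> by (intro mult_left_mono) auto
      also have "\<dots> = A * \<sigma> ^ s * (K * (2 * \<beta>))" by simp
      also have "\<dots> \<le> A * \<sigma> ^ s * (1/8)" using \<beta> A \<sigma> by (intro mult_left_mono) auto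
      finally have tail: "A * K * (\<Sum>k=1..s. (real s * b) ^ k * a ^ (s - k)) \<le> A * \<sigma> ^ s * (1/8)" .
      have "A * \<sigma> ^ s * (1/4) = \<sigma> ^ s / 2 * (A * (1/2))" by simp
      also have "\<dots> \<le> a ^ s * norm (gA (of_real (b * x)))"
        using a A \<sigma> big[OF bx] by (intro mult_mono) (auto simp: gA_def norm_mult)
      finally have main: "A * \<sigma> ^ s * (1/4) \<le> a ^ s * norm (gA (of_real (b * x)))" .
      have "a ^ s * norm (gA (of_real (b * x))) - A * K * (\<Sum>k=1..s. (real s * b) ^ k * a ^ (s - k))
          \<le> norm ((deriv ^^ s) f (of_real x))"
        unfolding f_def
      proof (rule higher_deriv_modulated_ge[OF gA _ a(1)])
        fix z :: complex assume z: "\<bar>Im z\<bar> \<le> 1"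
        have "norm (g z) \<le> G * exp (m * \<bar>Im z\<bar>)" by (rule growth)
        also have "\<dots> \<le> K" unfolding K_def using z pos by (intro mult_left_mono) auto
        finally show "norm (gA z) \<le> A * K" using A by (simp add: gA_def norm_mult)
      qed (use b in simp)
      with main tail show ?thesis by linarith
    qed
    have "ennreal (A * \<sigma> ^ s / 8 * (2 * (\<delta> / b)) powr \<theta>) \<le> Lp_norm q (on_reals ((deriv ^^ s) f))"
      unfolding \<theta>_def using pos b A \<sigma> by (intro Lp_norm_ge_on_interval \<open>0 < q\<close> lower) auto
    also have "A * \<sigma> ^ s / 8 * (2 * (\<delta> / b)) powr \<theta> = C * (\<sigma> ^ s * (\<sigma> / real s) powr (1/p - \<theta>))"
    proof -
      have "A = (1/I) powr (1/p) * b powr (1/p)" unfolding A_def by (simp flip: powr_mult)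
      moreover have "(2 * (\<delta> / b)) powr \<theta> = (2 * \<delta>) powr \<theta> / b powr \<theta>"
        by (simp flip: powr_divide)
      moreover have "b powr (1/p) / b powr \<theta> = \<beta> powr (1/p - \<theta>) * (\<sigma> / real s) powr (1/p - \<theta>)"
        unfolding powr_diff[symmetric] b_def by (rule powr_mult)
      moreover have "(1/I) powr (1/p) * b powr (1/p) * ((2 * \<delta>) powr \<theta> / b powr \<theta>)
          = (1/I) powr (1/p) * (2 * \<delta>) powr \<theta> * (b powr (1/p) / b powr \<theta>)"
        by (simp only: mult_ac times_divide_eq_left times_divide_eq_right)
      ultimately have "A * (2 * (\<delta> / b)) powr \<theta>
          = (1/I) powr (1/p) * (2 * \<delta>) powr \<theta> * (\<beta> powr (1/p - \<theta>) * (\<sigma> / real s) powr (1/p - \<theta>))"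
        by (simp only:)
      moreover have "A * \<sigma> ^ s / 8 * (2 * (\<delta> / b)) powr \<theta> = (A * (2 * (\<delta> / b)) powr \<theta>) * \<sigma> ^ s / 8"
        by (simp only: mult_ac times_divide_eq_left times_divide_eq_right)
      ultimately show ?thesis by (simp add: C_def mult_ac)
    qed
    finally show "\<exists>f\<in>E_space \<sigma> (ennreal p). Lp_norm (ennreal p) (on_reals f) = 1 \<and>
        ennreal (C * (\<sigma> ^ s * (\<sigma> / real s) powr (1/p - enn2real (1/q)))) \<le> Lp_norm q (on_reals ((deriv ^^ s) f))"
      using f \<open>exponential_type \<sigma> f\<close> norm_f unfolding \<theta>_def
      by (intro bexI[of _ f]) (auto simp: E_space_def)
  qed
qed

section \<open>The two-sided estimate\<close>

theorem theorem1p2: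
  fixes p q :: ennreal
  assumes "0 < p" and "p < q"
  shows "\<exists>C1 > 0. \<exists>C2 > 0. \<forall>\<sigma> :: real. \<forall>s :: nat. \<sigma> > 0 \<longrightarrow> s \<ge> 1 \<longrightarrow>
    (let A = (SUP f \<in> {f \<in> E_space \<sigma> p. Lp_norm p (on_reals f) = 1}.
               Lp_norm q (on_reals ((deriv ^^ s) f)));
         B = \<sigma> ^ s * (\<sigma> / real s) powr (enn2real (1 / p) - enn2real (1 / q))
     in ennreal (C2 * B) \<le> A \<and> A \<le> ennreal (C1 * B))"
proof -
  define P where "P = enn2real p"
  have "p < \<infinity>" using assms(2) using less_le_trans[OF _ top_greatest] by simp
  then have p: "p = ennreal P" by (simp add: P_def)
  have "0 < P" using assms(1) unfolding p by simp
  have "0 < q" using assms by (rule less_trans)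
  obtain C1 where C1: "0 < C1"
    "\<And>f \<sigma> s. f \<in> E_space \<sigma> (ennreal P) \<Longrightarrow> Lp_norm (ennreal P) (on_reals f) = 1 \<Longrightarrow> 0 < \<sigma> \<Longrightarrow> 1 \<le> s \<Longrightarrow>
      Lp_norm q (on_reals ((deriv ^^ s) f)) \<le> ennreal (C1 * (\<sigma> ^ s * (\<sigma> / real s) powr (1/P - enn2real (1/q))))"
    using Lp_norm_higher_deriv_le[OF \<open>0 < P\<close> assms(2)[unfolded p]] by blast
  obtain C2 where C2: "0 < C2"
    "\<And>\<sigma> s. 0 < \<sigma> \<Longrightarrow> 1 \<le> s \<Longrightarrow> \<exists>f\<in>E_space \<sigma> (ennreal P). Lp_norm (ennreal P) (on_reals f) = 1 \<and>
      ennreal (C2 * (\<sigma> ^ s * (\<sigma> / real s) powr (1/P - enn2real (1/q)))) \<le> Lp_norm q (on_reals ((deriv ^^ s) f))"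
    using Lp_norm_higher_deriv_ge[OF \<open>0 < P\<close> \<open>0 < q\<close>] by blast
  show ?thesis
    unfolding Let_def p enn2real_one_divide[OF \<open>0 < P\<close>]
  proof (rule exI[of _ C1], rule conjI[OF C1(1)], rule exI[of _ C2], rule conjI[OF C2(1)], intro allI impI conjI)
    fix \<sigma> :: real and s :: nat assume \<sigma>: "0 < \<sigma>" and s: "1 \<le> s"
    let ?B = "\<sigma> ^ s * (\<sigma> / real s) powr (1/P - enn2real (1/q))"
    let ?F = "{f \<in> E_space \<sigma> (ennreal P). Lp_norm (ennreal P) (on_reals f) = 1}"
    obtain f where f: "f \<in> ?F" "ennreal (C2 * ?B) \<le> Lp_norm q (on_reals ((deriv ^^ s) f))"
      using C2(2)[OF \<sigma> s] by blast
    show "ennreal (C2 * ?B) \<le> (SUP f \<in> ?F. Lp_norm q (on_reals ((deriv ^^ s) f)))"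
      using f by (intro SUP_upper2[where i = f]) auto
    show "(SUP f \<in> ?F. Lp_norm q (on_reals ((deriv ^^ s) f))) \<le> ennreal (C1 * ?B)"
      using C1(2) \<sigma> s by (intro SUP_least) auto
  qed
qed

end
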